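(* Let $\mathbb H$ be a subgroup of the additive group $\mathbb R$ with $1\in\mathbb H$, and let $M$ be a strong $\mathbb H$-perfect pseudo MV-algebra. Then there is a unique (up to isomorphism) $\ell$-group $G$ such that $M\cong\Gamma(\mathbb H\overrightarrow{\times}G,(1,0))$ (isomorphism of pseudo MV-algebras).
   Context: A pseudo MV-algebra (PMV-algebra) is an algebra $(M;\oplus,{}^-,{}^\sim,0,1)$ of type $(2,1,1,0,0)$ such that, with $y\odot x:=(x^-\oplus y^-)^\sim$ ($\odot$ binds tighter than $\oplus$), for all $x,y,z\in M$: (A1) $x\oplus(y\oplus z)=(x\oplus y)\oplus z$; (A2) $x\oplus0=0\oplus x=x$; (A3) $x\oplus1=1\oplus x=1$; (A4) $1^\sim=0$, $1^-=0$; (A5) $(x^-\oplus y^-)^\sim=(x^\sim\oplus y^\sim)^-$; (A6) $x\oplus(x^\sim\odot y)=y\oplus(y^\sim\odot x)=(x\odot y^-)\oplus y=(y\odot x^-)\oplus x$; (A7) $x\odot(x^-\oplus y)=(x\oplus y^\sim)\odot y$; (A8) $(x^-)^\sim=x$. The term in (A6) is the join $x\vee y$, the term in (A7) is the meet $x\wedge y$ of a distributive lattice with order $\le$. The partial addition: $x+y$ is defined iff $x\le y^-$, and then $x+y:=x\oplus y$. An $\ell$-group is a (not necessarily Abelian, additively written) lattice-ordered group; $C(G)$ denotes the center of $G$; a strong unit of $G$ is $u\ge0$ such that every $g\in G$ satisfies $g\le nu$ for some integer $n\ge1$; $(G,u)$ is then a unital $\ell$-group. $\Gamma(G,u):=[0,u]$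 with $x\oplus y=(x+y)\wedge u$, $x^-=u-x$, $x^\sim=-x+u$, $0$, $u$ is a PMV-algebra. Every PMV-algebra is isomorphic to $\Gamma(G,u)$ for a unital $\ell$-group $(G,u)$ unique up to isomorphism (known theorem), and $M$ is identified with $\Gamma(G,u)$. $\mathbb H\overrightarrow{\times}G$ is the lexicographic product: the group $\mathbb H\times G$ with $(h_1,g_1)\le(h_2,g_2)$ iff $h_1<h_2$, or $h_1=h_2$ and $g_1\le g_2$. $[0,1]_{\mathbb H}:=[0,1]\cap\mathbb H$. For subsets, $A\leqslant B$ means $a\le b$ for all $a\in A,b\in B$; $A^-=\{a^-:a\in A\}$, $A^\sim=\{a^\sim:a\in A\}$. An $\mathbb H$-decomposition of $M$ is a system $(M_t:t\in[0,1]_{\mathbb H})$ of nonempty, pairwise disjoint subsets of $M$ with union $M$ such that (a) $M_s\leqslant M_t$ for $s<t$; (b) $M_t^-=M_{1-t}=M_t^\sim$ for all $t$; (c) if $x\in M_v$, $y\in M_t$ then $x\oplus y\in M_{\min\{v+t,1\}}$. For $M=\Gamma(G,u)$, an $\mathbb H$-decomposition $(M_t)$ has the strong cyclic property if there are elements $(c_t\in M:t\in[0,1]_{\mathbb H})$ with (i) $c_t\in M_t\cap C(G)$ for all $t$; (ii) $c_v+c_t=c_{v+t}$ whenever $v+t\le1$; (iii) $c_1=1$ (the top element $u$ of $M$). A PMV-algebra is strong $\mathbb H$-perfect if it possesses an $\mathbb H$-decomposition with the strong cyclic property. *)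

theory Defs
  imports Complex_Main "HOL-Algebra.Group" "HOL-Algebra.Lattice"
begin

section \<open>Lattice-ordered groups\<close>

text \<open>
  The l-groups here need not be Abelian.  HOL-Algebra groups are written multiplicatively, so the
  additive \<open>x + y\<close>, \<open>0\<close>, \<open>- x\<close>, \<open>n x\<close> of the literature
  become \<open>x \<otimes> y\<close>, \<open>\<one>\<close>, \<open>inv x\<close>, \<open>x [^] n\<close>.
\<close>

record 'a lgroup = "'a monoid" +
  lle :: "'a \<Rightarrow> 'a \<Rightarrow> bool" (infixl "\<preceq>\<index>" 50)

definition order_of :: "'a lgroup \<Rightarrow> 'a gorder" where
  "order_of G = \<lparr>carrier = carrier G, eq = (=), le = lle G\<rparr>"

locale lgroup = group G for G :: "'a lgroup" (structure) +
  assumes lattice_order: "lattice (order_of G)"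
    and translation: "\<lbrakk>x \<in> carrier G; y \<in> carrier G; a \<in> carrier G; b \<in> carrier G; x \<preceq> y\<rbrakk>
          \<Longrightarrow> a \<otimes> x \<otimes> b \<preceq> a \<otimes> y \<otimes> b"

definition lgroup_iso :: "'a lgroup \<Rightarrow> 'b lgroup \<Rightarrow> ('a \<Rightarrow> 'b) set" where
  "lgroup_iso G G' = {f \<in> iso G G'.
     \<forall>x\<in>carrier G. \<forall>y\<in>carrier G. x \<preceq>\<^bsub>G\<^esub> y \<longleftrightarrow> f x \<preceq>\<^bsub>G'\<^esub> f y}"

definition lgroup_isomorphic :: "'a lgroup \<Rightarrow> 'b lgroup \<Rightarrow> bool" where
  "lgroup_isomorphic G G' \<longleftrightarrow> lgroup_iso G G' \<noteq> {}"

definition group_center :: "('a, 'm) monoid_scheme \<Rightarrow> 'a set" where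
  "group_center G = {z \<in> carrier G. \<forall>x\<in>carrier G. z \<otimes>\<^bsub>G\<^esub> x = x \<otimes>\<^bsub>G\<^esub> z}"

definition strong_unit :: "'a lgroup \<Rightarrow> 'a \<Rightarrow> bool" where
  "strong_unit G u \<longleftrightarrow> u \<in> carrier G \<and> \<one>\<^bsub>G\<^esub> \<preceq>\<^bsub>G\<^esub> u \<and>
     (\<forall>g\<in>carrier G. \<exists>n::nat. n \<ge> 1 \<and> g \<preceq>\<^bsub>G\<^esub> u [^]\<^bsub>G\<^esub> n)"

definition unital_lgroup :: "'a lgroup \<Rightarrow> 'a \<Rightarrow> bool" where
  "unital_lgroup G u \<longleftrightarrow> lgroup G \<and> strong_unit G u"

definition lex_lgroup :: "'a lgroup \<Rightarrow> 'b lgroup \<Rightarrow> ('a \<times> 'b) lgroup" where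
  "lex_lgroup A B = \<lparr>carrier = carrier (A \<times>\<times> B), monoid.mult = monoid.mult (A \<times>\<times> B), one = \<one>\<^bsub>A \<times>\<times> B\<^esub>,
     lle = (\<lambda>(h1, g1) (h2, g2).
        (h1 \<preceq>\<^bsub>A\<^esub> h2 \<and> h1 \<noteq> h2) \<or> (h1 = h2 \<and> g1 \<preceq>\<^bsub>B\<^esub> g2))\<rparr>"

definition real_lgroup :: "real lgroup" where
  "real_lgroup = \<lparr>carrier = UNIV, monoid.mult = (+), one = 0, lle = (\<le>)\<rparr>"


section \<open>Pseudo MV-algebras\<close>

text \<open>\<open>lneg\<close> is the operation \<open>x\<^sup>-\<close>, \<open>rneg\<close> is \<open>x\<^sup>~\<close>.\<close>

record 'a pmv = "'a partial_object" +
  padd :: "'a \<Rightarrow> 'a \<Rightarrow> 'a" (infixl "\<boxplus>\<index>" 65)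
  lneg :: "'a \<Rightarrow> 'a"
  rneg :: "'a \<Rightarrow> 'a"
  pzero :: "'a"
  pone :: "'a"

text \<open>Note the reversal of the arguments: \<open>y \<odot> x = (x\<^sup>- \<oplus> y\<^sup>-)\<^sup>~\<close>.\<close>

definition pmul :: "'a pmv \<Rightarrow> 'a \<Rightarrow> 'a \<Rightarrow> 'a" (infixl "\<boxdot>\<index>" 70) where
  "y \<boxdot>\<^bsub>M\<^esub> x = rneg M (lneg M x \<boxplus>\<^bsub>M\<^esub> lneg M y)"

locale pmv_algebra =
  fixes M :: "'a pmv" (structure)
  assumes padd_closed: "\<lbrakk>x \<in> carrier M; y \<in> carrier M\<rbrakk> \<Longrightarrow> x \<boxplus> y \<in> carrier M"
    and lneg_closed: "x \<in> carrier M \<Longrightarrow> lneg M x \<in> carrier M"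
    and rneg_closed: "x \<in> carrier M \<Longrightarrow> rneg M x \<in> carrier M"
    and pzero_closed: "pzero M \<in> carrier M"
    and pone_closed: "pone M \<in> carrier M"
    and A1: "\<lbrakk>x \<in> carrier M; y \<in> carrier M; z \<in> carrier M\<rbrakk>
          \<Longrightarrow> x \<boxplus> (y \<boxplus> z) = (x \<boxplus> y) \<boxplus> z"
    and A2: "x \<in> carrier M \<Longrightarrow> x \<boxplus> pzero M = x \<and> pzero M \<boxplus> x = x"
    and A3: "x \<in> carrier M \<Longrightarrow> x \<boxplus> pone M = pone M \<and> pone M \<boxplus> x = pone M"
    and A4: "rneg M (pone M) = pzero M \<and> lneg M (pone M) = pzero M"
    and A5: "\<lbrakk>x \<in> carrier M; y \<in> carrier M\<rbrakk>
          \<Longrightarrow> rneg M (lneg M x \<boxplus> lneg M y) = lneg M (rneg M x \<boxplus> rneg M y)"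
    and A6: "\<lbrakk>x \<in> carrier M; y \<in> carrier M\<rbrakk>
          \<Longrightarrow> x \<boxplus> (rneg M x \<boxdot> y) = y \<boxplus> (rneg M y \<boxdot> x)
            \<and> y \<boxplus> (rneg M y \<boxdot> x) = (x \<boxdot> lneg M y) \<boxplus> y
            \<and> (x \<boxdot> lneg M y) \<boxplus> y = (y \<boxdot> lneg M x) \<boxplus> x"
    and A7: "\<lbrakk>x \<in> carrier M; y \<in> carrier M\<rbrakk>
          \<Longrightarrow> x \<boxdot> (lneg M x \<boxplus> y) = (x \<boxplus> rneg M y) \<boxdot> y"
    and A8: "x \<in> carrier M \<Longrightarrow> rneg M (lneg M x) = x"

definition pmv_meet :: "'a pmv \<Rightarrow> 'a \<Rightarrow> 'a \<Rightarrow> 'a" where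
  "pmv_meet M x y = x \<boxdot>\<^bsub>M\<^esub> (lneg M x \<boxplus>\<^bsub>M\<^esub> y)"

definition pmv_le :: "'a pmv \<Rightarrow> 'a \<Rightarrow> 'a \<Rightarrow> bool" where
  "pmv_le M x y \<longleftrightarrow> pmv_meet M x y = x"

text \<open>The partial addition; \<open>None\<close> stands for undefined.\<close>

definition pmv_plus :: "'a pmv \<Rightarrow> 'a \<Rightarrow> 'a \<Rightarrow> 'a option" where
  "pmv_plus M x y = (if pmv_le M x (lneg M y) then Some (x \<boxplus>\<^bsub>M\<^esub> y) else None)"

definition pmv_iso :: "'a pmv \<Rightarrow> 'b pmv \<Rightarrow> ('a \<Rightarrow> 'b) set" where
  "pmv_iso M N = {f. bij_betw f (carrier M) (carrier N)
     \<and> (\<forall>x\<in>carrier M. \<forall>y\<in>carrier M. f (x \<boxplus>\<^bsub>M\<^esub> y) = f x \<boxplus>\<^bsub>N\<^esub> f y)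
     \<and> (\<forall>x\<in>carrier M. f (lneg M x) = lneg N (f x))
     \<and> (\<forall>x\<in>carrier M. f (rneg M x) = rneg N (f x))
     \<and> f (pzero M) = pzero N \<and> f (pone M) = pone N}"

definition pmv_isomorphic :: "'a pmv \<Rightarrow> 'b pmv \<Rightarrow> bool" where
  "pmv_isomorphic M N \<longleftrightarrow> pmv_iso M N \<noteq> {}"

definition pmv_Gamma :: "'a lgroup \<Rightarrow> 'a \<Rightarrow> 'a pmv" where
  "pmv_Gamma G u = \<lparr>carrier = {x \<in> carrier G. \<one>\<^bsub>G\<^esub> \<preceq>\<^bsub>G\<^esub> x \<and> x \<preceq>\<^bsub>G\<^esub> u},
     padd = (\<lambda>x y. (x \<otimes>\<^bsub>G\<^esub> y) \<sqinter>\<^bsub>order_of G\<^esub> u),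
     lneg = (\<lambda>x. u \<otimes>\<^bsub>G\<^esub> inv\<^bsub>G\<^esub> x),
     rneg = (\<lambda>x. inv\<^bsub>G\<^esub> x \<otimes>\<^bsub>G\<^esub> u),
     pzero = \<one>\<^bsub>G\<^esub>,
     pone = u\<rparr>"

text \<open>
  The identification of \<open>M\<close> with \<open>\<Gamma>(K, u)\<close> is made explicit as an isomorphism \<open>\<phi>\<close>.
  By the representation theorem for pseudo MV-algebras every \<open>M\<close> has one, and \<open>(K, u)\<close> is
  unique up to isomorphism.
\<close>

definition pmv_representation :: "'a pmv \<Rightarrow> 'b lgroup \<Rightarrow> 'b \<Rightarrow> ('a \<Rightarrow> 'b) \<Rightarrow> bool" where
  "pmv_representation M K u \<phi> \<longleftrightarrow> unital_lgroup K u \<and> \<phi> \<in> pmv_iso M (pmv_Gamma K u)"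


section \<open>Strong H-perfect pseudo MV-algebras\<close>

text \<open>Only the values \<open>D t\<close> for \<open>t\<close> in \<open>unit_interval H\<close> matter.\<close>

definition unit_interval :: "real set \<Rightarrow> real set" where
  "unit_interval H = {0..1} \<inter> H"

definition H_decomposition :: "real set \<Rightarrow> 'a pmv \<Rightarrow> (real \<Rightarrow> 'a set) \<Rightarrow> bool" where
  "H_decomposition H M D \<longleftrightarrow>
     (\<forall>t\<in>unit_interval H. D t \<noteq> {})
   \<and> (\<forall>s\<in>unit_interval H. \<forall>t\<in>unit_interval H. s \<noteq> t \<longrightarrow> D s \<inter> D t = {})
   \<and> (\<Union>t\<in>unit_interval H. D t) = carrier M
   \<and> (\<forall>s\<in>unit_interval H. \<forall>t\<in>unit_interval H. s < t \<longrightarrow>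
        (\<forall>x\<in>D s. \<forall>y\<in>D t. pmv_le M x y))
   \<and> (\<forall>t\<in>unit_interval H. lneg M ` D t = D (1 - t) \<and> D (1 - t) = rneg M ` D t)
   \<and> (\<forall>v\<in>unit_interval H. \<forall>t\<in>unit_interval H. \<forall>x\<in>D v. \<forall>y\<in>D t.
        x \<boxplus>\<^bsub>M\<^esub> y \<in> D (min (v + t) 1))"

text \<open>Centrality of \<open>c t\<close> is meant in the l-group \<open>K\<close> representing \<open>M\<close>.\<close>

definition strong_cyclic ::
  "real set \<Rightarrow> 'a pmv \<Rightarrow> 'b lgroup \<Rightarrow> ('a \<Rightarrow> 'b) \<Rightarrow> (real \<Rightarrow> 'a set) \<Rightarrow> bool" where
  "strong_cyclic H M K \<phi> D \<longleftrightarrow> (\<exists>c :: real \<Rightarrow> 'a.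
     (\<forall>t\<in>unit_interval H. c t \<in> D t \<and> \<phi> (c t) \<in> group_center K)
   \<and> (\<forall>v\<in>unit_interval H. \<forall>t\<in>unit_interval H. v + t \<le> 1 \<longrightarrow>
        pmv_plus M (c v) (c t) = Some (c (v + t)))
   \<and> c 1 = pone M)"

definition strong_H_perfect ::
  "real set \<Rightarrow> 'a pmv \<Rightarrow> 'b lgroup \<Rightarrow> ('a \<Rightarrow> 'b) \<Rightarrow> bool" where
  "strong_H_perfect H M K \<phi> \<longleftrightarrow> (\<exists>D. H_decomposition H M D \<and> strong_cyclic H M K \<phi> D)"

end

theory Submission
  imports Defs "HOL-Algebra.Coset"
begin

text \<open>
  Identify the algebra with the interval \<open>[0, u]\<close> of \<open>K\<close>, let \<open>E t\<close> be the blocks of the decomposition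
  and let \<open>S\<close> consist of the \<open>g\<close> with \<open>- d \<le> g \<le> d\<close> for some \<open>d \<in> E 0\<close>; it is a convex
  \<open>l\<close>-subgroup.  For \<open>x \<in> E t\<close> with \<open>t < 1\<close> the positive and negative parts \<open>d\<close>, \<open>d'\<close> of \<open>x - c t\<close>
  satisfy \<open>c t + d = x + d'\<close>, which forces them into a common block \<open>E s\<close> with \<open>s < 1\<close>.  If \<open>s > 0\<close>, then
  \<open>d' \<le> (d + d) \<and> u\<close> because the latter lies in a higher block; as \<open>d\<close> and \<open>d'\<close> are disjoint this gives
  \<open>d' = 0\<close>, a contradiction.  Hence \<open>x - c t \<in> S\<close>, and \<open>(t, g) \<mapsto> c t + g\<close> is the required isomorphism.

  For uniqueness, the elements \<open>(0, g)\<close> of \<open>\<Gamma>(H \<times> G, (1, 0))\<close> are exactly those none of whose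
  \<open>\<oplus>\<close>-multiples is the top element.  An isomorphism of the algebras therefore restricts to an isomorphism of
  the positive cones, which extends to the \<open>l\<close>-groups.
\<close>

section \<open>Lattice-ordered groups\<close>

text \<open>The meet is a choice among greatest lower bounds, and antisymmetry makes that choice
  unique. Antisymmetry on the carrier is the only order axiom assumed, so that the lemma also
  applies to the lexicographic product, whose \<open>lgroup\<close> axioms are not
  established.\<close>

lemma meet_order_of_eqI:
  fixes L :: "'a lgroup"
  assumes anti: "\<And>a b. \<lbrakk>a \<in> carrier L; b \<in> carrier L; a \<preceq>\<^bsub>L\<^esub> b; b \<preceq>\<^bsub>L\<^esub> a\<rbrakk> \<Longrightarrow> a = b"
    and "x \<in> carrier L" "y \<in> carrier L" "m \<in> carrier L"
    and "m \<preceq>\<^bsub>L\<^esub> x" "m \<preceq>\<^bsub>L\<^esub> y"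
    and "\<And>z. \<lbrakk>z \<in> carrier L; z \<preceq>\<^bsub>L\<^esub> x; z \<preceq>\<^bsub>L\<^esub> y\<rbrakk> \<Longrightarrow> z \<preceq>\<^bsub>L\<^esub> m"
  shows "x \<sqinter>\<^bsub>order_of L\<^esub> y = m"
proof -
  have "(\<lambda>z. greatest (order_of L) z (Lower (order_of L) {x, y})) = (\<lambda>z. z = m)"
  proof (intro ext iffI)
    fix z assume "greatest (order_of L) z (Lower (order_of L) {x, y})"
    then show "z = m"
      using assms(2-) by (intro anti) (auto simp: order_of_def greatest_def Lower_def)
  qed (use assms(2-) in \<open>auto simp: order_of_def greatest_def Lower_def\<close>)
  then show ?thesis
    by (simp add: meet_def inf_def)
qed

context lgroup
begin

lemma order_of_simps [simp]:
  "carrier (order_of G) = carrier G" "le (order_of G) = lle G" "eq (order_of G) = (=)"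
  by (simp_all add: order_of_def)

lemma le_refl [simp]: "x \<in> carrier G \<Longrightarrow> x \<preceq> x"
  using lattice_order weak_partial_order.le_refl[of "order_of G" x]
  unfolding lattice_def upper_semilattice_def partial_order_def by simp

lemma le_antisym:
  "\<lbrakk>x \<preceq> y; y \<preceq> x; x \<in> carrier G; y \<in> carrier G\<rbrakk> \<Longrightarrow> x = y"
  using lattice_order partial_order.le_antisym[of "order_of G" x y]
  unfolding lattice_def upper_semilattice_def by simp

lemma le_trans:
  "\<lbrakk>x \<preceq> y; y \<preceq> z; x \<in> carrier G; y \<in> carrier G; z \<in> carrier G\<rbrakk> \<Longrightarrow> x \<preceq> z"
  using lattice_order weak_partial_order.le_trans[of "order_of G" x y z]
  unfolding lattice_def upper_semilattice_def partial_order_def by simp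

lemma weak_lattice_order_of: "weak_lattice (order_of G)"
  using lattice_order
  unfolding lattice_def upper_semilattice_def lower_semilattice_def weak_lattice_def
    weak_upper_semilattice_def weak_lower_semilattice_def partial_order_def
    upper_semilattice_axioms_def lower_semilattice_axioms_def
    weak_upper_semilattice_axioms_def weak_lower_semilattice_axioms_def
  by simp

abbreviation ljoin :: "'a \<Rightarrow> 'a \<Rightarrow> 'a" (infixl "\<squnion>\<^sub>l" 65)
  where "x \<squnion>\<^sub>l y \<equiv> x \<squnion>\<^bsub>order_of G\<^esub> y"

abbreviation lmeet :: "'a \<Rightarrow> 'a \<Rightarrow> 'a" (infixl "\<sqinter>\<^sub>l" 70)
  where "x \<sqinter>\<^sub>l y \<equiv> x \<sqinter>\<^bsub>order_of G\<^esub> y"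

lemma assumes "x \<in> carrier G" "y \<in> carrier G"
  shows join_closed [simp]: "x \<squnion>\<^sub>l y \<in> carrier G"
    and join_left: "x \<preceq> x \<squnion>\<^sub>l y"
    and join_right: "y \<preceq> x \<squnion>\<^sub>l y"
    and join_least: "\<lbrakk>z \<in> carrier G; x \<preceq> z; y \<preceq> z\<rbrakk> \<Longrightarrow> x \<squnion>\<^sub>l y \<preceq> z"
    and meet_closed [simp]: "x \<sqinter>\<^sub>l y \<in> carrier G"
    and meet_left: "x \<sqinter>\<^sub>l y \<preceq> x"
    and meet_right: "x \<sqinter>\<^sub>l y \<preceq> y"
    and meet_greatest: "\<lbrakk>z \<in> carrier G; z \<preceq> x; z \<preceq> y\<rbrakk> \<Longrightarrow> z \<preceq> x \<sqinter>\<^sub>l y"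
proof -
  interpret L: weak_lattice "order_of G" by (rule weak_lattice_order_of)
  show "x \<squnion>\<^sub>l y \<in> carrier G" "x \<preceq> x \<squnion>\<^sub>l y" "y \<preceq> x \<squnion>\<^sub>l y"
       "x \<sqinter>\<^sub>l y \<in> carrier G" "x \<sqinter>\<^sub>l y \<preceq> x" "x \<sqinter>\<^sub>l y \<preceq> y"
    using assms L.join_closed L.join_left L.join_right L.meet_closed L.meet_left L.meet_right
    by auto
  show "\<lbrakk>z \<in> carrier G; x \<preceq> z; y \<preceq> z\<rbrakk> \<Longrightarrow> x \<squnion>\<^sub>l y \<preceq> z"
       "\<lbrakk>z \<in> carrier G; z \<preceq> x; z \<preceq> y\<rbrakk> \<Longrightarrow> z \<preceq> x \<sqinter>\<^sub>l y"
    using assms L.join_le[of x z y] L.meet_le[of z x y] by auto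
qed

lemma inv_cancel [simp]:
  assumes "x \<in> carrier G" "y \<in> carrier G"
  shows "x \<otimes> (inv x \<otimes> y) = y" "inv x \<otimes> (x \<otimes> y) = y"
  using assms by (simp_all flip: m_assoc)

lemma mult_left_mono:
  "\<lbrakk>x \<preceq> y; a \<in> carrier G; x \<in> carrier G; y \<in> carrier G\<rbrakk> \<Longrightarrow> a \<otimes> x \<preceq> a \<otimes> y"
  using translation[of x y a \<one>] by simp

lemma mult_right_mono:
  "\<lbrakk>x \<preceq> y; a \<in> carrier G; x \<in> carrier G; y \<in> carrier G\<rbrakk> \<Longrightarrow> x \<otimes> a \<preceq> y \<otimes> a"
  using translation[of x y \<one> a] by simp

lemma mult_mono:
  "\<lbrakk>x \<preceq> y; a \<preceq> b; x \<in> carrier G; y \<in> carrier G; a \<in> carrier G; b \<in> carrier G\<rbrakk>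
    \<Longrightarrow> x \<otimes> a \<preceq> y \<otimes> b"
  using le_trans[of "x \<otimes> a" "y \<otimes> a" "y \<otimes> b"] mult_left_mono mult_right_mono by simp

lemma mult_left_le_cancel:
  "\<lbrakk>a \<in> carrier G; x \<in> carrier G; y \<in> carrier G\<rbrakk> \<Longrightarrow> a \<otimes> x \<preceq> a \<otimes> y \<longleftrightarrow> x \<preceq> y"
  using mult_left_mono[of x y a] mult_left_mono[of "a \<otimes> x" "a \<otimes> y" "inv a"] by auto

lemma inv_antimono:
  assumes "x \<preceq> y" "x \<in> carrier G" "y \<in> carrier G"
  shows "inv y \<preceq> inv x"
  using translation[of x y "inv x" "inv y"] assms by (simp add: m_assoc)

lemma one_le_mult:
  "\<lbrakk>\<one> \<preceq> x; \<one> \<preceq> y; x \<in> carrier G; y \<in> carrier G\<rbrakk> \<Longrightarrow> \<one> \<preceq> x \<otimes> y"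
  using mult_mono[of \<one> x \<one> y] by simp

lemma le_iff_one_le:
  assumes "x \<in> carrier G" "y \<in> carrier G"
  shows "x \<preceq> y \<longleftrightarrow> \<one> \<preceq> inv x \<otimes> y"
  using mult_left_le_cancel[of "inv x" x y] assms by simp

lemma meet_eqI:
  assumes "x \<in> carrier G" "y \<in> carrier G" "m \<in> carrier G" "m \<preceq> x" "m \<preceq> y"
    and "\<And>z. \<lbrakk>z \<in> carrier G; z \<preceq> x; z \<preceq> y\<rbrakk> \<Longrightarrow> z \<preceq> m"
  shows "x \<sqinter>\<^sub>l y = m"
  by (rule meet_order_of_eqI[OF _ assms]) (simp_all add: le_antisym)

lemma one_le_join: "x \<in> carrier G \<Longrightarrow> \<one> \<preceq> x \<squnion>\<^sub>l \<one>"
  by (simp add: join_right)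

text \<open>Left translation shows that \<open>inv x \<otimes> (x \<squnion>\<^sub>l \<one>)\<close>
  is the join of \<open>\<one>\<close> and \<open>inv x\<close>, that is, the negative part of
  \<open>x\<close>. This form keeps a single join in all later calculations.\<close>

lemma pos_part_decomp:
  assumes "x \<in> carrier G"
  shows "x = (x \<squnion>\<^sub>l \<one>) \<otimes> inv (inv x \<otimes> (x \<squnion>\<^sub>l \<one>))" "\<one> \<preceq> inv x \<otimes> (x \<squnion>\<^sub>l \<one>)"
  using assms le_iff_one_le[of x "x \<squnion>\<^sub>l \<one>"] join_left[of x \<one>]
  by (simp_all add: inv_mult_group flip: m_assoc)

lemma le_imp_one_le_div: "\<lbrakk>x \<preceq> y; x \<in> carrier G; y \<in> carrier G\<rbrakk> \<Longrightarrow> \<one> \<preceq> y \<otimes> inv x"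
  using mult_right_mono[of x y "inv x"] by simp

lemma meet_absorb: "\<lbrakk>x \<preceq> y; x \<in> carrier G; y \<in> carrier G\<rbrakk> \<Longrightarrow> x \<sqinter>\<^sub>l y = x"
  by (rule meet_eqI) auto

lemma mult_meet_distrib:
  assumes "a \<in> carrier G" "x \<in> carrier G" "y \<in> carrier G"
  shows "(a \<otimes> x) \<sqinter>\<^sub>l (a \<otimes> y) = a \<otimes> (x \<sqinter>\<^sub>l y)"
proof (rule meet_eqI)
  fix z assume z: "z \<in> carrier G" "z \<preceq> a \<otimes> x" "z \<preceq> a \<otimes> y"
  then have "inv a \<otimes> z \<preceq> x" "inv a \<otimes> z \<preceq> y"
    using mult_left_le_cancel[of a "inv a \<otimes> z"] assms by auto
  then have "inv a \<otimes> z \<preceq> x \<sqinter>\<^sub>l y"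
    using assms z by (simp add: meet_greatest)
  then show "z \<preceq> a \<otimes> (x \<sqinter>\<^sub>l y)"
    using mult_left_mono[of "inv a \<otimes> z" "x \<sqinter>\<^sub>l y" a] assms z by simp
qed (use assms in \<open>auto simp: meet_left meet_right mult_left_mono\<close>)

lemma le_mult_left: "\<lbrakk>\<one> \<preceq> a; a \<in> carrier G; x \<in> carrier G\<rbrakk> \<Longrightarrow> x \<preceq> a \<otimes> x"
  using mult_right_mono[of \<one> a x] by simp

lemma le_mult_right: "\<lbrakk>\<one> \<preceq> a; a \<in> carrier G; x \<in> carrier G\<rbrakk> \<Longrightarrow> x \<preceq> x \<otimes> a"
  using mult_left_mono[of \<one> a x] by simp

lemma inv_le_one: "\<lbrakk>\<one> \<preceq> a; a \<in> carrier G\<rbrakk> \<Longrightarrow> inv a \<preceq> \<one>"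
  using inv_antimono[of \<one> a] by simp

text \<open>Let \<open>d\<close> be the positive part of \<open>g\<close>. A common lower bound
  \<open>z\<close> of both parts makes \<open>d - z\<close> an upper bound of \<open>g\<close> and
  \<open>0\<close>, so \<open>d \<le> d - z\<close> because \<open>d\<close> is the least
  one.\<close>

lemma pos_neg_parts_disjoint:
  assumes "g \<in> carrier G" "z \<in> carrier G"
    and "z \<preceq> g \<squnion>\<^sub>l \<one>" "z \<preceq> inv g \<otimes> (g \<squnion>\<^sub>l \<one>)"
  shows "z \<preceq> \<one>"
proof -
  define d where "d = g \<squnion>\<^sub>l \<one>"
  have d: "d \<in> carrier G" using assms by (simp add: d_def)
  have "\<one> \<preceq> d \<otimes> inv z"
    using le_imp_one_le_div[of z d] assms d by (simp add: d_def)
  moreover have "g \<preceq> d \<otimes> inv z"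
  proof -
    have "g \<otimes> z \<preceq> g \<otimes> (inv g \<otimes> d)"
      using assms d by (intro mult_left_mono) (simp_all add: d_def)
    then have "g \<otimes> z \<otimes> inv z \<preceq> d \<otimes> inv z"
      using assms d by (intro mult_right_mono) simp_all
    then show ?thesis using assms by (simp add: m_assoc)
  qed
  ultimately have "d \<preceq> d \<otimes> inv z"
    using assms d by (simp add: d_def join_least)
  then have "\<one> \<preceq> inv z"
    using mult_left_le_cancel[of d \<one> "inv z"] assms d by simp
  then show ?thesis
    using inv_le_one[of "inv z"] assms by simp
qed

end

section \<open>Extending an isomorphism of positive cones to the groups\<close>

locale cone_iso = G: lgroup G + G': lgroup G' for G :: "'a lgroup" and G' :: "'b lgroup" +
  fixes \<theta> :: "'a \<Rightarrow> 'b"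
  assumes bij: "bij_betw \<theta> {x \<in> carrier G. \<one>\<^bsub>G\<^esub> \<preceq>\<^bsub>G\<^esub> x} {x \<in> carrier G'. \<one>\<^bsub>G'\<^esub> \<preceq>\<^bsub>G'\<^esub> x}"
    and mult: "\<lbrakk>x \<in> carrier G; y \<in> carrier G; \<one>\<^bsub>G\<^esub> \<preceq>\<^bsub>G\<^esub> x; \<one>\<^bsub>G\<^esub> \<preceq>\<^bsub>G\<^esub> y\<rbrakk>
      \<Longrightarrow> \<theta> (x \<otimes>\<^bsub>G\<^esub> y) = \<theta> x \<otimes>\<^bsub>G'\<^esub> \<theta> y"
begin

abbreviation pos :: "'a \<Rightarrow> bool"
  where "pos x \<equiv> x \<in> carrier G \<and> \<one>\<^bsub>G\<^esub> \<preceq>\<^bsub>G\<^esub> x"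

text \<open>Taking one canonical difference, positive part minus negative part, makes
  well-definedness automatic. \<open>cone_ext_quotient\<close> shows that any other difference of
  positive elements gives the same value.\<close>

definition cone_ext :: "'a \<Rightarrow> 'b"
  where "cone_ext x = \<theta> (x \<squnion>\<^bsub>order_of G\<^esub> \<one>\<^bsub>G\<^esub>)
    \<otimes>\<^bsub>G'\<^esub> inv\<^bsub>G'\<^esub> \<theta> (inv\<^bsub>G\<^esub> x \<otimes>\<^bsub>G\<^esub> (x \<squnion>\<^bsub>order_of G\<^esub> \<one>\<^bsub>G\<^esub>))"

lemma image_pos: "pos x \<Longrightarrow> \<theta> x \<in> carrier G'" "pos x \<Longrightarrow> \<one>\<^bsub>G'\<^esub> \<preceq>\<^bsub>G'\<^esub> \<theta> x"
  using bij by (auto simp: bij_betw_def)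

lemma ex_pos_preimage:
  assumes "z \<in> carrier G'" "\<one>\<^bsub>G'\<^esub> \<preceq>\<^bsub>G'\<^esub> z"
  shows "\<exists>a. pos a \<and> \<theta> a = z"
proof -
  have "z \<in> \<theta> ` {x \<in> carrier G. \<one>\<^bsub>G\<^esub> \<preceq>\<^bsub>G\<^esub> x}"
    using bij assms by (simp add: bij_betw_def)
  then show ?thesis by auto
qed

lemma inj_pos: "\<lbrakk>\<theta> x = \<theta> y; pos x; pos y\<rbrakk> \<Longrightarrow> x = y"
  using bij by (auto simp: bij_betw_def inj_on_def)

lemma image_one: "\<theta> \<one>\<^bsub>G\<^esub> = \<one>\<^bsub>G'\<^esub>"
  using mult[of "\<one>\<^bsub>G\<^esub>" "\<one>\<^bsub>G\<^esub>"] image_pos(1)[of "\<one>\<^bsub>G\<^esub>"] by simp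

text \<open>Since \<open>a\<close> is positive and above \<open>g = a - b\<close>, it is above the
  positive part \<open>p\<close> of \<open>g\<close>. The positive remainder \<open>e\<close> with
  \<open>a = p + e\<close> also satisfies \<open>b = q + e\<close> for the negative part
  \<open>q\<close>, and \<open>\<theta> e\<close> cancels in the difference.\<close>

lemma cone_ext_quotient:
  assumes "pos a" "pos b"
  shows "cone_ext (a \<otimes>\<^bsub>G\<^esub> inv\<^bsub>G\<^esub> b) = \<theta> a \<otimes>\<^bsub>G'\<^esub> inv\<^bsub>G'\<^esub> \<theta> b"
proof -
  define g where "g = a \<otimes>\<^bsub>G\<^esub> inv\<^bsub>G\<^esub> b"
  define p where "p = g \<squnion>\<^bsub>order_of G\<^esub> \<one>\<^bsub>G\<^esub>"
  define q where "q = inv\<^bsub>G\<^esub> g \<otimes>\<^bsub>G\<^esub> p"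
  define e where "e = inv\<^bsub>G\<^esub> p \<otimes>\<^bsub>G\<^esub> a"
  have g: "g \<in> carrier G" using assms by (simp add: g_def)
  have p: "pos p" and q: "pos q"
    using g G.pos_part_decomp[of g] by (auto simp: p_def q_def G.one_le_join)
  have "g \<preceq>\<^bsub>G\<^esub> a"
    using G.mult_left_mono[of "\<one>\<^bsub>G\<^esub>" b g] g assms by (simp add: g_def G.m_assoc)
  then have "p \<preceq>\<^bsub>G\<^esub> a" using assms g by (simp add: p_def G.join_least)
  then have e: "pos e"
    using G.le_iff_one_le[of p a] p assms by (simp add: e_def)
  have a: "a = p \<otimes>\<^bsub>G\<^esub> e" using p assms by (simp add: e_def)
  have b: "b = q \<otimes>\<^bsub>G\<^esub> e"
    using p g assms by (simp add: e_def q_def G.m_assoc) (simp add: g_def G.inv_mult_group G.m_assoc)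
  have "\<theta> a \<otimes>\<^bsub>G'\<^esub> inv\<^bsub>G'\<^esub> \<theta> b = \<theta> p \<otimes>\<^bsub>G'\<^esub> inv\<^bsub>G'\<^esub> \<theta> q"
    unfolding a b using p q e
    by (simp add: mult image_pos G'.inv_mult_group G'.m_assoc)
  then show ?thesis by (simp add: cone_ext_def g_def p_def q_def)
qed

lemma cone_ext_pos: "pos a \<Longrightarrow> cone_ext a = \<theta> a"
  using cone_ext_quotient[of a "\<one>\<^bsub>G\<^esub>"] by (simp add: image_one image_pos)

lemma obtain_quotient:
  assumes "x \<in> carrier G"
  obtains a b where "pos a" "pos b" "x = a \<otimes>\<^bsub>G\<^esub> inv\<^bsub>G\<^esub> b"
proof (rule that)
  show "x = (x \<squnion>\<^bsub>order_of G\<^esub> \<one>\<^bsub>G\<^esub>) \<otimes>\<^bsub>G\<^esub> inv\<^bsub>G\<^esub> (inv\<^bsub>G\<^esub> x \<otimes>\<^bsub>G\<^esub> (x \<squnion>\<^bsub>order_of G\<^esub> \<one>\<^bsub>G\<^esub>))"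
    using assms by (rule G.pos_part_decomp)
qed (use assms in \<open>simp_all add: G.pos_part_decomp G.one_le_join\<close>)

lemma cone_ext_closed: "x \<in> carrier G \<Longrightarrow> cone_ext x \<in> carrier G'"
  by (rule obtain_quotient[of x]) (auto simp: cone_ext_quotient image_pos)

text \<open>Without commutativity the middle factor \<open>inv b \<otimes> c\<close> has to be
  turned round: it is again a difference of positives \<open>p \<otimes> inv q\<close>. The
  equivalent equation \<open>c \<otimes> q = b \<otimes> p\<close> lives in the cone, so
  \<open>\<theta>\<close> carries it to \<open>G'\<close>.\<close>

lemma cone_ext_mult:
  assumes "x \<in> carrier G" "y \<in> carrier G"
  shows "cone_ext (x \<otimes>\<^bsub>G\<^esub> y) = cone_ext x \<otimes>\<^bsub>G'\<^esub> cone_ext y"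
proof -
  obtain a b where ab: "pos a" "pos b" "x = a \<otimes>\<^bsub>G\<^esub> inv\<^bsub>G\<^esub> b"
    using assms(1) by (rule obtain_quotient)
  obtain c d where cd: "pos c" "pos d" "y = c \<otimes>\<^bsub>G\<^esub> inv\<^bsub>G\<^esub> d"
    using assms(2) by (rule obtain_quotient)
  obtain p q where pq: "pos p" "pos q" "inv\<^bsub>G\<^esub> b \<otimes>\<^bsub>G\<^esub> c = p \<otimes>\<^bsub>G\<^esub> inv\<^bsub>G\<^esub> q"
    using ab cd by (auto intro: obtain_quotient[of "inv\<^bsub>G\<^esub> b \<otimes>\<^bsub>G\<^esub> c"])
  note [simp] = image_pos ab(1,2) cd(1,2) pq(1,2)
  have "c = b \<otimes>\<^bsub>G\<^esub> (inv\<^bsub>G\<^esub> b \<otimes>\<^bsub>G\<^esub> c)" by simp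
  then have "c \<otimes>\<^bsub>G\<^esub> q = b \<otimes>\<^bsub>G\<^esub> p" 
    unfolding pq(3) by (metis (no_types) G.m_assoc G.inv_closed G.m_closed G.l_inv G.r_one ab(2) pq(1,2))
  then have "\<theta> c \<otimes>\<^bsub>G'\<^esub> \<theta> q = \<theta> b \<otimes>\<^bsub>G'\<^esub> \<theta> p"
    by (simp flip: mult)
  then have *: "inv\<^bsub>G'\<^esub> \<theta> b \<otimes>\<^bsub>G'\<^esub> \<theta> c = \<theta> p \<otimes>\<^bsub>G'\<^esub> inv\<^bsub>G'\<^esub> \<theta> q"
    by (subst G'.inv_solve_left') (simp_all add: G'.inv_solve_right flip: G'.m_assoc)
  have "x \<otimes>\<^bsub>G\<^esub> y = a \<otimes>\<^bsub>G\<^esub> (inv\<^bsub>G\<^esub> b \<otimes>\<^bsub>G\<^esub> c) \<otimes>\<^bsub>G\<^esub> inv\<^bsub>G\<^esub> d"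
    by (simp add: ab(3) cd(3) G.m_assoc)
  also have "\<dots> = (a \<otimes>\<^bsub>G\<^esub> p) \<otimes>\<^bsub>G\<^esub> inv\<^bsub>G\<^esub> (d \<otimes>\<^bsub>G\<^esub> q)"
    unfolding pq(3) by (simp add: G.m_assoc G.inv_mult_group)
  finally have "cone_ext (x \<otimes>\<^bsub>G\<^esub> y) = \<theta> (a \<otimes>\<^bsub>G\<^esub> p) \<otimes>\<^bsub>G'\<^esub> inv\<^bsub>G'\<^esub> \<theta> (d \<otimes>\<^bsub>G\<^esub> q)"
    by (simp add: cone_ext_quotient G.one_le_mult)
  also have "\<dots> = \<theta> a \<otimes>\<^bsub>G'\<^esub> (\<theta> p \<otimes>\<^bsub>G'\<^esub> inv\<^bsub>G'\<^esub> \<theta> q) \<otimes>\<^bsub>G'\<^esub> inv\<^bsub>G'\<^esub> \<theta> d"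
    by (simp add: mult G'.inv_mult_group G'.m_assoc)
  also have "\<dots> = cone_ext x \<otimes>\<^bsub>G'\<^esub> cone_ext y"
    by (simp add: ab(3) cd(3) cone_ext_quotient G'.m_assoc flip: *)
  finally show ?thesis .
qed

lemma cone_ext_hom: "cone_ext \<in> hom G G'"
  by (simp add: hom_def cone_ext_closed cone_ext_mult)

lemma cone_ext_inj: "\<lbrakk>cone_ext x = \<one>\<^bsub>G'\<^esub>; x \<in> carrier G\<rbrakk> \<Longrightarrow> x = \<one>\<^bsub>G\<^esub>"
  by (rule obtain_quotient[of x])
     (auto simp: cone_ext_quotient image_pos G'.inv_solve_right' dest: inj_pos)

lemma cone_ext_bij: "bij_betw cone_ext (carrier G) (carrier G')"
proof -
  interpret group_hom G G' cone_ext
    by unfold_locales (rule cone_ext_hom)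
  have "inj_on cone_ext (carrier G)"
    using cone_ext_inj by (simp add: inj_on_one_iff)
  moreover have "cone_ext ` carrier G = carrier G'"
  proof (intro equalityI subsetI)
    fix y assume y: "y \<in> carrier G'"
    obtain a where "pos a" "\<theta> a = y \<squnion>\<^bsub>order_of G'\<^esub> \<one>\<^bsub>G'\<^esub>"
      using ex_pos_preimage[of "y \<squnion>\<^bsub>order_of G'\<^esub> \<one>\<^bsub>G'\<^esub>"] y G'.one_le_join[OF y] by auto
    moreover obtain b where "pos b" "\<theta> b = inv\<^bsub>G'\<^esub> y \<otimes>\<^bsub>G'\<^esub> (y \<squnion>\<^bsub>order_of G'\<^esub> \<one>\<^bsub>G'\<^esub>)"
      using ex_pos_preimage[of "inv\<^bsub>G'\<^esub> y \<otimes>\<^bsub>G'\<^esub> (y \<squnion>\<^bsub>order_of G'\<^esub> \<one>\<^bsub>G'\<^esub>)"] y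
        G'.pos_part_decomp(2)[OF y] by auto
    ultimately have "cone_ext (a \<otimes>\<^bsub>G\<^esub> inv\<^bsub>G\<^esub> b) = y"
      using G'.pos_part_decomp(1)[OF y] by (simp only: cone_ext_quotient)
    then show "y \<in> cone_ext ` carrier G"
      using \<open>pos a\<close> \<open>pos b\<close> by (intro image_eqI[where x = "a \<otimes>\<^bsub>G\<^esub> inv\<^bsub>G\<^esub> b"]) simp_all
  qed (auto simp: cone_ext_closed)
  ultimately show ?thesis by (simp add: bij_betw_def)
qed

lemma cone_ext_one_le_iff:
  assumes "x \<in> carrier G"
  shows "\<one>\<^bsub>G'\<^esub> \<preceq>\<^bsub>G'\<^esub> cone_ext x \<longleftrightarrow> \<one>\<^bsub>G\<^esub> \<preceq>\<^bsub>G\<^esub> x"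
proof
  assume "\<one>\<^bsub>G'\<^esub> \<preceq>\<^bsub>G'\<^esub> cone_ext x"
  \<comment> \<open>A positive \<open>cone_ext x\<close> is some \<open>\<theta> p\<close>, which is
    also \<open>cone_ext p\<close>; injectivity then identifies \<open>p\<close> with
    \<open>x\<close>.\<close>
  then obtain p where p: "pos p" "\<theta> p = cone_ext x"
    using ex_pos_preimage[of "cone_ext x"] cone_ext_closed[OF assms] by auto
  then have "p = x"
    using cone_ext_bij assms by (auto simp: bij_betw_def inj_on_def cone_ext_pos)
  then show "\<one>\<^bsub>G\<^esub> \<preceq>\<^bsub>G\<^esub> x" using p by simp
qed (use assms in \<open>simp add: cone_ext_pos image_pos\<close>)

theorem cone_ext_lgroup_iso: "cone_ext \<in> lgroup_iso G G'"
proof -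
  interpret group_hom G G' cone_ext
    by unfold_locales (rule cone_ext_hom)
  have "x \<preceq>\<^bsub>G\<^esub> y \<longleftrightarrow> cone_ext x \<preceq>\<^bsub>G'\<^esub> cone_ext y" if "x \<in> carrier G" "y \<in> carrier G" for x y
    using that cone_ext_one_le_iff[of "inv\<^bsub>G\<^esub> x \<otimes>\<^bsub>G\<^esub> y"]
    by (simp add: G.le_iff_one_le[of x y] G'.le_iff_one_le[of "cone_ext x"])
  then show ?thesis
    by (simp add: lgroup_iso_def iso_def cone_ext_hom cone_ext_bij)
qed

end

section \<open>Isomorphisms of pseudo MV-algebras\<close>

text \<open>Closure is assumed operation by operation instead of through \<open>pmv_algebra\<close>,
  because the lemma is also applied to the algebra of a lexicographic product, for which only
  closure is checked.\<close>

lemma pmv_iso_inv_into: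
  assumes padd_closed: "\<And>x y. \<lbrakk>x \<in> carrier M; y \<in> carrier M\<rbrakk> \<Longrightarrow> x \<boxplus>\<^bsub>M\<^esub> y \<in> carrier M"
    and lneg_closed: "\<And>x. x \<in> carrier M \<Longrightarrow> lneg M x \<in> carrier M"
    and rneg_closed: "\<And>x. x \<in> carrier M \<Longrightarrow> rneg M x \<in> carrier M"
    and pzero_closed: "pzero M \<in> carrier M" and pone_closed: "pone M \<in> carrier M"
    and f: "f \<in> pmv_iso M N"
  shows "inv_into (carrier M) f \<in> pmv_iso N M"
proof -
  have bij: "bij_betw f (carrier M) (carrier N)" using f by (simp add: pmv_iso_def)
  have left: "inv_into (carrier M) f (f x) = x" if "x \<in> carrier M" for x
    using bij that by (simp add: bij_betw_def)
  have ex: "\<exists>a\<in>carrier M. f a = x" if "x \<in> carrier N" for x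
    using bij_betw_imp_surj_on[OF bij] that by (metis imageE)
  have "inv_into (carrier M) f (x \<boxplus>\<^bsub>N\<^esub> y) = inv_into (carrier M) f x \<boxplus>\<^bsub>M\<^esub> inv_into (carrier M) f y"
    if "x \<in> carrier N" "y \<in> carrier N" for x y
  proof -
    obtain a b where "a \<in> carrier M" "f a = x" "b \<in> carrier M" "f b = y"
      using ex \<open>x \<in> carrier N\<close> \<open>y \<in> carrier N\<close> by blast
    then show ?thesis
      using f left[of a] left[of b] left[of "a \<boxplus>\<^bsub>M\<^esub> b"] padd_closed[of a b]
      by (auto simp: pmv_iso_def)
  qed
  moreover have "inv_into (carrier M) f (lneg N x) = lneg M (inv_into (carrier M) f x)
      \<and> inv_into (carrier M) f (rneg N x) = rneg M (inv_into (carrier M) f x)"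
    if x: "x \<in> carrier N" for x
  proof -
    obtain a where "a \<in> carrier M" "f a = x" using ex[OF x] by blast
    then show ?thesis
      using f left[of a] left[of "lneg M a"] left[of "rneg M a"] lneg_closed[of a] rneg_closed[of a]
      by (auto simp: pmv_iso_def)
  qed
  moreover have "inv_into (carrier M) f (pzero N) = pzero M" "inv_into (carrier M) f (pone N) = pone M"
    using f left[OF pzero_closed] left[OF pone_closed] by (simp_all add: pmv_iso_def)
  ultimately show ?thesis
    using bij_betw_inv_into[OF bij] by (simp add: pmv_iso_def)
qed

lemma pmv_iso_comp:
  assumes "f \<in> pmv_iso M N" "g \<in> pmv_iso N P"
  shows "g \<circ> f \<in> pmv_iso M P"
proof -
  have "f x \<in> carrier N" if "x \<in> carrier M" for x
    using assms(1) that by (auto simp: pmv_iso_def bij_betw_def)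
  then show ?thesis
    using assms by (auto simp: pmv_iso_def intro: bij_betw_trans)
qed

lemma pmv_isomorphic_trans:
  "\<lbrakk>pmv_isomorphic M N; pmv_isomorphic N P\<rbrakk> \<Longrightarrow> pmv_isomorphic M P"
  unfolding pmv_isomorphic_def using pmv_iso_comp by blast

lemma (in pmv_algebra) pmv_isomorphic_sym: "pmv_isomorphic M N \<Longrightarrow> pmv_isomorphic N M"
  unfolding pmv_isomorphic_def
  using pmv_iso_inv_into[OF padd_closed lneg_closed rneg_closed pzero_closed pone_closed] by blast

text \<open>Being phrased through sum, zero and top alone, this is invariant under isomorphism. In
  the algebra of a lexicographic product it singles out the first coordinate \<open>0\<close>, which
  is how uniqueness recovers the group.\<close>

definition infinitesimal :: "'a pmv \<Rightarrow> 'a \<Rightarrow> bool"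
  where "infinitesimal M x \<longleftrightarrow> (\<forall>n. (padd M x ^^ n) (pzero M) \<noteq> pone M)"

lemma pmv_iso_infinitesimal:
  assumes f: "f \<in> pmv_iso M N"
    and closed: "\<And>x y. \<lbrakk>x \<in> carrier M; y \<in> carrier M\<rbrakk> \<Longrightarrow> x \<boxplus>\<^bsub>M\<^esub> y \<in> carrier M"
    and units: "pzero M \<in> carrier M" "pone M \<in> carrier M"
    and x: "x \<in> carrier M"
  shows "infinitesimal N (f x) \<longleftrightarrow> infinitesimal M x"
proof -
  have mult: "(padd M x ^^ n) (pzero M) \<in> carrier M
      \<and> f ((padd M x ^^ n) (pzero M)) = (padd N (f x) ^^ n) (pzero N)" for n
    using f x closed units by (induction n) (auto simp: pmv_iso_def)
  have "inj_on f (carrier M)" "f (pone M) = pone N"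
    using f by (auto simp: pmv_iso_def bij_betw_def)
  then have "(padd N (f x) ^^ n) (pzero N) = pone N \<longleftrightarrow> (padd M x ^^ n) (pzero M) = pone M" for n
    using mult[of n] units by (metis inj_on_eq_iff)
  then show ?thesis by (simp add: infinitesimal_def)
qed

lemma pmv_iso_le:
  assumes "pmv_algebra M" "f \<in> pmv_iso M N" "x \<in> carrier M" "y \<in> carrier M" "pmv_le M x y"
  shows "pmv_le N (f x) (f y)"
proof -
  interpret pmv_algebra M by fact
  have hom: "\<And>x y. \<lbrakk>x \<in> carrier M; y \<in> carrier M\<rbrakk> \<Longrightarrow> f (x \<boxplus>\<^bsub>M\<^esub> y) = f x \<boxplus>\<^bsub>N\<^esub> f y"
    "\<And>x. x \<in> carrier M \<Longrightarrow> f (lneg M x) = lneg N (f x)"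
    "\<And>x. x \<in> carrier M \<Longrightarrow> f (rneg M x) = rneg N (f x)"
    using assms(2) by (auto simp: pmv_iso_def)
  have "f (pmv_meet M x y) = pmv_meet N (f x) (f y)"
    using assms(3,4) padd_closed lneg_closed rneg_closed by (simp add: pmv_meet_def pmul_def hom)
  then show ?thesis using assms(5) by (simp add: pmv_le_def)
qed

section \<open>The algebra of a lexicographic product\<close>

locale unital_real_subgroup =
  fixes H :: "real set"
  assumes H_subgroup: "subgroup H real_lgroup" and one_in_H: "1 \<in> H"
begin

lemma zero_in_H: "0 \<in> H"
  using subgroup.one_closed[OF H_subgroup] by (simp add: real_lgroup_def)

lemma add_in_H: "\<lbrakk>s \<in> H; t \<in> H\<rbrakk> \<Longrightarrow> s + t \<in> H"
  using subgroup.m_closed[OF H_subgroup] by (simp add: real_lgroup_def)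

lemma uminus_in_H:
  assumes "t \<in> H"
  shows "- t \<in> H"
proof -
  have "inv\<^bsub>real_lgroup\<^esub> t = - t"
    unfolding m_inv_def by (rule the_equality) (auto simp: real_lgroup_def)
  then show ?thesis
    using subgroup.m_inv_closed[OF H_subgroup assms] by simp
qed

lemma diff_in_H: "\<lbrakk>s \<in> H; t \<in> H\<rbrakk> \<Longrightarrow> s - t \<in> H"
  using add_in_H[of s "- t"] uminus_in_H by simp

lemma unit_interval_iff: "t \<in> unit_interval H \<longleftrightarrow> t \<in> H \<and> 0 \<le> t \<and> t \<le> 1"
  by (auto simp: unit_interval_def)

end

locale real_lex = lgroup G + unital_real_subgroup H for G :: "'a lgroup" (structure) and H
begin

abbreviation L :: "(real \<times> 'a) lgroup"
  where "L \<equiv> lex_lgroup (real_lgroup\<lparr>carrier := H\<rparr>) G"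

abbreviation \<Gamma> :: "(real \<times> 'a) pmv"
  where "\<Gamma> \<equiv> pmv_Gamma L (1, \<one>)"

lemma lex_simps [simp]:
  "carrier L = H \<times> carrier G"
  "(s, g) \<otimes>\<^bsub>L\<^esub> (t, k) = (s + t, g \<otimes> k)"
  "\<one>\<^bsub>L\<^esub> = (0, \<one>)"
  "(s, g) \<preceq>\<^bsub>L\<^esub> (t, k) \<longleftrightarrow> s < t \<or> s = t \<and> g \<preceq> k"
  by (auto simp: lex_lgroup_def real_lgroup_def DirProd_def)

lemma lex_inv:
  assumes "t \<in> H" "g \<in> carrier G"
  shows "inv\<^bsub>L\<^esub> (t, g) = (- t, inv g)"
  unfolding m_inv_def[of L]
proof (rule the_equality)
  fix y assume y: "y \<in> carrier L \<and> (t, g) \<otimes>\<^bsub>L\<^esub> y = \<one>\<^bsub>L\<^esub> \<and> y \<otimes>\<^bsub>L\<^esub> (t, g) = \<one>\<^bsub>L\<^esub>"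
  show "y = (- t, inv g)"
    using y assms inv_equality[of "snd y" g] by (cases y) auto
qed (use assms uminus_in_H in auto)

text \<open>First coordinates decide the comparison with the unit except at \<open>t = 1\<close>,
  the only case in which a meet of the second factor enters.\<close>

lemma lex_meet_unit:
  assumes "t \<in> H" "g \<in> carrier G"
  shows "(t, g) \<sqinter>\<^bsub>order_of L\<^esub> (1, \<one>) =
    (if t < 1 then (t, g) else if t = 1 then (1, g \<sqinter>\<^sub>l \<one>) else (1, \<one>))"
proof (rule meet_order_of_eqI)
  fix a b assume "a \<in> carrier L" "b \<in> carrier L" "a \<preceq>\<^bsub>L\<^esub> b" "b \<preceq>\<^bsub>L\<^esub> a"
  then show "a = b"
    by (cases a, cases b) (auto intro: le_antisym)
next
  fix z assume "z \<in> carrier L" "z \<preceq>\<^bsub>L\<^esub> (t, g)" "z \<preceq>\<^bsub>L\<^esub> (1, \<one>)"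
  then show "z \<preceq>\<^bsub>L\<^esub> (if t < 1 then (t, g) else if t = 1 then (1, g \<sqinter>\<^sub>l \<one>) else (1, \<one>))"
    using assms by (cases z) (auto simp: meet_greatest)
qed (use assms one_in_H in \<open>auto simp: meet_left meet_right\<close>)

lemma Gamma_simps [simp]:
  "(t, g) \<in> carrier \<Gamma> \<longleftrightarrow> t \<in> H \<and> g \<in> carrier G
    \<and> (0 < t \<or> t = 0 \<and> \<one> \<preceq> g) \<and> (t < 1 \<or> t = 1 \<and> g \<preceq> \<one>)"
  "pzero \<Gamma> = (0, \<one>)" "pone \<Gamma> = (1, \<one>)"
  by (auto simp: pmv_Gamma_def)

lemma Gamma_padd:
  assumes "s \<in> H" "g \<in> carrier G" "t \<in> H" "k \<in> carrier G"
  shows "(s, g) \<boxplus>\<^bsub>\<Gamma>\<^esub> (t, k) =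
    (if s + t < 1 then (s + t, g \<otimes> k) else if s + t = 1 then (1, (g \<otimes> k) \<sqinter>\<^sub>l \<one>) else (1, \<one>))"
  using assms by (simp add: pmv_Gamma_def lex_meet_unit add_in_H)

lemma Gamma_neg:
  assumes "t \<in> H" "g \<in> carrier G"
  shows "lneg \<Gamma> (t, g) = (1 - t, inv g)" "rneg \<Gamma> (t, g) = (1 - t, inv g)"
  using assms by (simp_all add: pmv_Gamma_def lex_inv)

lemma Gamma_padd_closed:
  assumes "x \<in> carrier \<Gamma>" "y \<in> carrier \<Gamma>"
  shows "x \<boxplus>\<^bsub>\<Gamma>\<^esub> y \<in> carrier \<Gamma>"
proof -
  obtain s g t k where xy: "x = (s, g)" "y = (t, k)" by fastforce
  show ?thesis
    using assms unfolding xy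
    by (auto simp: Gamma_padd add_in_H one_in_H one_le_mult meet_right)
qed

text \<open>First coordinates add with truncation at \<open>1\<close>, so the \<open>n\<close>-fold
  sum has first coordinate \<open>min (n * t) 1\<close>. This stays \<open>0\<close> for
  \<open>t = 0\<close>, and by the Archimedean property it reaches \<open>1\<close> for
  \<open>t > 0\<close>.\<close>

lemma infinitesimal_iff:
  assumes "(t, g) \<in> carrier \<Gamma>"
  shows "infinitesimal \<Gamma> (t, g) \<longleftrightarrow> t = 0"
proof
  have tg: "t \<in> H" "g \<in> carrier G" "0 \<le> t" using assms by auto
  have multiples: "\<exists>k\<in>carrier G. (padd \<Gamma> (t, g) ^^ n) (pzero \<Gamma>) = (min (n * t) 1, k)
      \<and> min (n * t) 1 \<in> H" for n
  proof (induction n)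
    case 0
    then show ?case by (simp add: zero_in_H)
  next
    case (Suc n)
    then obtain k where k: "k \<in> carrier G" "min (n * t) 1 \<in> H"
      "(padd \<Gamma> (t, g) ^^ n) (pzero \<Gamma>) = (min (n * t) 1, k)"
      by auto
    have "min (t + min (n * t) 1) 1 \<in> H"
      using add_in_H[OF tg(1) k(2)] one_in_H by (simp add: min_def)
    moreover have "min (t + min (n * t) 1) 1 = min (Suc n * t) 1"
      using tg by (auto simp: min_def algebra_simps)
    moreover have "\<exists>l\<in>carrier G. (t, g) \<boxplus>\<^bsub>\<Gamma>\<^esub> (min (n * t) 1, k) = (min (t + min (n * t) 1) 1, l)"
      using tg k by (simp add: Gamma_padd)
    ultimately show ?case
      using k by (auto simp del: of_nat_Suc)
  qed
  {
    assume i: "infinitesimal \<Gamma> (t, g)"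
    show "t = 0"
    proof (rule ccontr)
      assume "t \<noteq> 0"
      then have "t > 0" using tg by simp
      then obtain n :: nat where n: "1 < n * t" using reals_Archimedean3[of t] by blast
      obtain k where k: "k \<in> carrier G" "(padd \<Gamma> (t, g) ^^ n) (pzero \<Gamma>) = (1, k)"
        using multiples[of n] n by auto
      \<comment> \<open>The sum \<open>(1, k)\<close> may still lie strictly below the top. One more
        summand pushes the first coordinate beyond \<open>1\<close>, and truncation then yields the
        top exactly.\<close>
      have "(padd \<Gamma> (t, g) ^^ Suc n) (pzero \<Gamma>) = pone \<Gamma>"
        using k tg \<open>t > 0\<close> one_in_H by (simp add: Gamma_padd)
      then show False using i by (auto simp only: infinitesimal_def)
    qed
  }
  assume "t = 0"
  then have "(padd \<Gamma> (t, g) ^^ n) (pzero \<Gamma>) \<noteq> pone \<Gamma>" for n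
    using multiples[of n] by auto
  then show "infinitesimal \<Gamma> (t, g)"
    by (simp add: infinitesimal_def)
qed

lemma Gamma_pmv_isomorphic_sym:
  assumes "pmv_isomorphic \<Gamma> N"
  shows "pmv_isomorphic N \<Gamma>"
proof -
  obtain f where f: "f \<in> pmv_iso \<Gamma> N" using assms by (auto simp: pmv_isomorphic_def)
  have neg: "lneg \<Gamma> x \<in> carrier \<Gamma> \<and> rneg \<Gamma> x \<in> carrier \<Gamma>" if "x \<in> carrier \<Gamma>" for x
    using that inv_antimono[of \<one> "snd x"] inv_antimono[of "snd x" \<one>] one_in_H diff_in_H
    by (cases x) (auto simp: Gamma_neg)
  have "inv_into (carrier \<Gamma>) f \<in> pmv_iso N \<Gamma>"
    by (rule pmv_iso_inv_into[OF _ _ _ _ _ f])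
       (use Gamma_padd_closed neg zero_in_H one_in_H in auto)
  then show ?thesis by (auto simp: pmv_isomorphic_def)
qed

end

section \<open>Uniqueness of the second factor\<close>

lemma lex_Gamma_isomorphic_imp:
  fixes G :: "'a lgroup" and G' :: "'b lgroup"
  assumes "real_lex G H" "real_lex G' H"
    and iso: "pmv_isomorphic (pmv_Gamma (lex_lgroup (real_lgroup\<lparr>carrier := H\<rparr>) G) (1, \<one>\<^bsub>G\<^esub>))
               (pmv_Gamma (lex_lgroup (real_lgroup\<lparr>carrier := H\<rparr>) G') (1, \<one>\<^bsub>G'\<^esub>))"
  shows "lgroup_isomorphic G G'"
proof -
  interpret G: real_lex G H by fact
  interpret G': real_lex G' H by fact
  obtain f where f: "f \<in> pmv_iso G.\<Gamma> G'.\<Gamma>"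
    using iso by (auto simp: pmv_isomorphic_def)
  have bij: "bij_betw f (carrier G.\<Gamma>) (carrier G'.\<Gamma>)"
    and add: "\<lbrakk>x \<in> carrier G.\<Gamma>; y \<in> carrier G.\<Gamma>\<rbrakk> \<Longrightarrow> f (x \<boxplus>\<^bsub>G.\<Gamma>\<^esub> y) = f x \<boxplus>\<^bsub>G'.\<Gamma>\<^esub> f y" for x y
    using f by (auto simp: pmv_iso_def)
  define C where "C = {x \<in> carrier G. \<one>\<^bsub>G\<^esub> \<preceq>\<^bsub>G\<^esub> x}"
  define C' where "C' = {x \<in> carrier G'. \<one>\<^bsub>G'\<^esub> \<preceq>\<^bsub>G'\<^esub> x}"
  define \<theta> where "\<theta> = (\<lambda>g. snd (f (0, g)))"
  have C_in: "(0, g) \<in> carrier G.\<Gamma> \<longleftrightarrow> g \<in> C" for g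
    using G.zero_in_H by (auto simp: C_def)
  have C'_in: "(0, g) \<in> carrier G'.\<Gamma> \<longleftrightarrow> g \<in> C'" for g
    using G.zero_in_H by (auto simp: C'_def)
  \<comment> \<open>On both sides first coordinate \<open>0\<close> means infinitesimal, a property
    that \<open>f\<close> preserves and reflects.\<close>
  have fst_f: "fst (f x) = 0 \<longleftrightarrow> fst x = 0" if x: "x \<in> carrier G.\<Gamma>" for x
  proof -
    have fx: "f x \<in> carrier G'.\<Gamma>" using bij x by (auto simp: bij_betw_def)
    have "infinitesimal G'.\<Gamma> (f x) \<longleftrightarrow> infinitesimal G.\<Gamma> x"
      by (rule pmv_iso_infinitesimal[OF f])
         (use G.Gamma_padd_closed G.zero_in_H G.one_in_H x in auto)
    then show ?thesis
      using G.infinitesimal_iff[of "fst x" "snd x"] G'.infinitesimal_iff[of "fst (f x)" "snd (f x)"] x fx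
      by (simp del: G.Gamma_simps G'.Gamma_simps)
  qed
  have f_zero: "f (0, g) = (0, \<theta> g)" if "g \<in> C" for g
    using fst_f[of "(0, g)"] that by (metis C_in \<theta>_def fst_conv prod.collapse)
  have \<theta>_in: "\<theta> g \<in> C'" if "g \<in> C" for g
    using that bij f_zero[OF that] C_in[of g] C'_in[of "\<theta> g"] bij_betw_apply by fastforce
  have "bij_betw \<theta> C C'"
  proof (rule bij_betw_imageI)
    show "inj_on \<theta> C"
    proof (rule inj_onI)
      fix g k assume gk: "g \<in> C" "k \<in> C" "\<theta> g = \<theta> k"
      then have "f (0, g) = f (0, k)" by (simp add: f_zero)
      then have "(0, g) = (0 :: real, k)"
        using bij_betw_imp_inj_on[OF bij] gk C_in by (metis inj_onD)
      then show "g = k" by simp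
    qed
    show "\<theta> ` C = C'"
    proof (intro equalityI subsetI)
      fix k assume "k \<in> C'"
      then have "(0, k) \<in> f ` carrier G.\<Gamma>" using bij C'_in by (simp add: bij_betw_def)
      then obtain x where x: "x \<in> carrier G.\<Gamma>" "f x = (0, k)" by auto
      then have "x = (0, snd x)" using fst_f[of x] by (cases x) auto
      then show "k \<in> \<theta> ` C"
        using x C_in by (metis \<theta>_def image_eqI snd_conv)
    qed (use \<theta>_in in auto)
  qed
  moreover have "\<theta> (g \<otimes>\<^bsub>G\<^esub> k) = \<theta> g \<otimes>\<^bsub>G'\<^esub> \<theta> k" if "g \<in> C" "k \<in> C" for g k
  proof -
    have gk: "g \<otimes>\<^bsub>G\<^esub> k \<in> C" using that by (simp add: C_def G.one_le_mult)
    \<comment> \<open>Sums of elements with first coordinate \<open>0\<close> never reach the unit,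
      so no truncation occurs and the algebra sum is the group operation.\<close>
    have "(0, \<theta> (g \<otimes>\<^bsub>G\<^esub> k)) = f ((0, g) \<boxplus>\<^bsub>G.\<Gamma>\<^esub> (0, k))"
      using that gk by (simp add: f_zero C_def G.Gamma_padd G.zero_in_H)
    also have "\<dots> = (0, \<theta> g) \<boxplus>\<^bsub>G'.\<Gamma>\<^esub> (0, \<theta> k)"
      using that by (simp only: add C_in f_zero)
    also have "\<dots> = (0, \<theta> g \<otimes>\<^bsub>G'\<^esub> \<theta> k)"
      using \<theta>_in that by (simp add: C'_def G'.Gamma_padd G.zero_in_H)
    finally show ?thesis by simp
  qed
  ultimately interpret cone_iso G G' \<theta>
    by unfold_locales (simp_all add: C_def C'_def)
  show ?thesis
    using cone_ext_lgroup_iso by (auto simp: lgroup_isomorphic_def)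
qed

section \<open>Strong perfect unit intervals\<close>

text \<open>The decomposition and its cyclic elements are carried over to the interval
  \<open>[0, u]\<close> of \<open>K\<close>, so that all arguments become group arithmetic; only
  \<open>E_add\<close> still shows the truncation.\<close>

locale perfect_interval = lgroup K + unital_real_subgroup H
  for K :: "'b lgroup" (structure) and H :: "real set" +
  fixes u :: 'b and E :: "real \<Rightarrow> 'b set" and c :: "real \<Rightarrow> 'b"
  assumes u: "u \<in> carrier K" "\<one> \<preceq> u"
    and E_cover: "(\<Union>t\<in>unit_interval H. E t) = {x \<in> carrier K. \<one> \<preceq> x \<and> x \<preceq> u}"
    and E_disjoint: "\<lbrakk>s \<in> unit_interval H; t \<in> unit_interval H; x \<in> E s; x \<in> E t\<rbrakk> \<Longrightarrow> s = t"
    and E_less: "\<lbrakk>s \<in> unit_interval H; t \<in> unit_interval H; s < t; x \<in> E s; y \<in> E t\<rbrakk> \<Longrightarrow> x \<preceq> y"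
    and E_neg: "\<lbrakk>t \<in> unit_interval H; x \<in> E t\<rbrakk> \<Longrightarrow> u \<otimes> inv x \<in> E (1 - t)"
    and E_add: "\<lbrakk>s \<in> unit_interval H; t \<in> unit_interval H; x \<in> E s; y \<in> E t\<rbrakk>
      \<Longrightarrow> (x \<otimes> y) \<sqinter>\<^bsub>order_of K\<^esub> u \<in> E (min (s + t) 1)"
    and c_in: "t \<in> unit_interval H \<Longrightarrow> c t \<in> E t"
    and c_center: "t \<in> unit_interval H \<Longrightarrow> c t \<in> group_center K"
    and c_add: "\<lbrakk>s \<in> unit_interval H; t \<in> unit_interval H; s + t \<le> 1\<rbrakk> \<Longrightarrow> c s \<otimes> c t = c (s + t)"
    and c_one: "c 1 = u"
begin

abbreviation I :: "real set" where "I \<equiv> unit_interval H"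

lemma zero_in_I [simp]: "0 \<in> I" and one_in_I [simp]: "1 \<in> I"
  using zero_in_H one_in_H by (simp_all add: unit_interval_iff)

lemma E_D:
  assumes "x \<in> E t" "t \<in> I"
  shows "x \<in> carrier K" "\<one> \<preceq> x" "x \<preceq> u"
  using assms E_cover by auto

lemma obtain_level:
  assumes "x \<in> carrier K" "\<one> \<preceq> x" "x \<preceq> u"
  obtains t where "t \<in> I" "x \<in> E t"
  using assms E_cover by blast

lemma c_closed [simp]: "t \<in> I \<Longrightarrow> c t \<in> carrier K"
  using c_in E_D by blast

lemma c_commute: "\<lbrakk>t \<in> I; x \<in> carrier K\<rbrakk> \<Longrightarrow> c t \<otimes> x = x \<otimes> c t"
  using c_center by (auto simp: group_center_def)

lemma c_zero: "c 0 = \<one>"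
  using c_add[of 0 0] by (simp add: l_cancel_one)

lemma one_in_E0: "\<one> \<in> E 0"
  using c_in[of 0] by (simp add: c_zero)

text \<open>If \<open>t < s\<close>, the order of the blocks gives \<open>y \<preceq> x\<close> as
  well, so one element would lie in two disjoint blocks.\<close>

lemma E_level_mono:
  assumes "s \<in> I" "t \<in> I" "x \<in> E s" "y \<in> E t" "x \<preceq> y"
  shows "s \<le> t"
proof (rule ccontr)
  assume "\<not> s \<le> t"
  then have "y \<preceq> x" using E_less[of t s y x] assms by simp
  then have "x = y" using assms E_D le_antisym by blast
  then show False using E_disjoint[of s t x] assms \<open>\<not> s \<le> t\<close> by simp
qed

lemma E_mult:
  assumes "s \<in> I" "t \<in> I" "x \<in> E s" "y \<in> E t" "x \<otimes> y \<preceq> u"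
  shows "x \<otimes> y \<in> E (min (s + t) 1)"
  using E_add[of s t x y] meet_absorb[of "x \<otimes> y" u] assms E_D u by auto

text \<open>The difference \<open>u - y\<close> lies in the top block \<open>E 1\<close>, hence
  above \<open>x\<close>. So \<open>x + y\<close> stays below \<open>u\<close>, and the block rule
  for truncated sums applies to the plain sum.\<close>

lemma E0_mult:
  assumes "x \<in> E 0" "y \<in> E 0"
  shows "x \<otimes> y \<in> E 0"
proof -
  have xy: "x \<in> carrier K" "y \<in> carrier K" using assms E_D zero_in_I by blast+
  have "x \<preceq> u \<otimes> inv y"
    using E_less[of 0 1 x] E_neg[of 0 y] assms by simp
  then have "x \<otimes> y \<preceq> u"
    using mult_right_mono[of x "u \<otimes> inv y" y] xy u by (simp add: m_assoc)
  then show ?thesis using E_mult[of 0 0 x y] assms by simp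
qed

section \<open>The convex subgroup spanned by the lowest block\<close>

definition S :: "'b set"
  where "S = {g \<in> carrier K. \<exists>d\<in>E 0. inv d \<preceq> g \<and> g \<preceq> d}"

lemma S_I: "\<lbrakk>d \<in> E 0; inv d \<preceq> g; g \<preceq> d; g \<in> carrier K\<rbrakk> \<Longrightarrow> g \<in> S"
  unfolding S_def by blast

lemma S_E:
  assumes "g \<in> S"
  obtains d where "d \<in> E 0" "inv d \<preceq> g" "g \<preceq> d"
  using assms unfolding S_def by blast

lemma S_closed [simp]: "g \<in> S \<Longrightarrow> g \<in> carrier K"
  by (simp add: S_def)

lemma E0_D:
  assumes "d \<in> E 0"
  shows "d \<in> carrier K" "\<one> \<preceq> d"
  using E_D[OF assms zero_in_I] by simp_all

lemma S_convex:
  assumes "a \<in> S" "b \<in> S" "a \<preceq> g" "g \<preceq> b" "g \<in> carrier K"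
  shows "g \<in> S"
proof -
  obtain d where d: "d \<in> E 0" "inv d \<preceq> a" using assms(1) by (rule S_E)
  obtain e where e: "e \<in> E 0" "b \<preceq> e" using assms(2) by (rule S_E)
  note de' = E0_D[OF d(1)] E0_D[OF e(1)]
  have "g \<preceq> e" using le_trans[of g b e] d e assms de' by simp
  \<comment> \<open>Membership in \<open>S\<close> asks for one symmetric bound. As \<open>d\<close>
    and \<open>e\<close> are positive, \<open>d \<otimes> e\<close> dominates both and serves on
    either side.\<close>
  then have "g \<preceq> d \<otimes> e"
    using le_trans[of g e "d \<otimes> e"] le_mult_left[of d e] assms de' by simp
  have "inv d \<preceq> g" using le_trans[of "inv d" a g] d e assms de' by simp
  moreover have "inv (d \<otimes> e) \<preceq> inv d"
    using inv_antimono[of d "d \<otimes> e"] le_mult_right[of e d] de' by simp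
  ultimately have "inv (d \<otimes> e) \<preceq> g"
    using le_trans[of "inv (d \<otimes> e)" "inv d" g] assms de' by simp
  then show ?thesis
    by (rule S_I[OF E0_mult[OF d(1) e(1)] _ \<open>g \<preceq> d \<otimes> e\<close> assms(5)])
qed

lemma E0_in_S:
  assumes "d \<in> E 0"
  shows "d \<in> S"
proof -
  note d = E0_D[OF assms]
  have "inv d \<preceq> d" using le_trans[of "inv d" \<one> d] inv_le_one[of d] d by simp
  then show ?thesis using d assms by (intro S_I[of d]) simp_all
qed

lemma S_inv:
  assumes "g \<in> S"
  shows "inv g \<in> S"
proof -
  obtain d where d: "d \<in> E 0" "inv d \<preceq> g" "g \<preceq> d" using assms S_E by blast
  then have "inv d \<preceq> inv g" "inv g \<preceq> d"
    using inv_antimono[of g d] inv_antimono[of "inv d" g] E0_D(1)[OF d(1)] assms by simp_all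
  then show ?thesis using d assms by (intro S_I[of d]) simp_all
qed

lemma S_mult:
  assumes "g \<in> S" "k \<in> S"
  shows "g \<otimes> k \<in> S"
proof -
  obtain d where d: "d \<in> E 0" "inv d \<preceq> g" "g \<preceq> d" using assms S_E by blast
  obtain e where e: "e \<in> E 0" "inv e \<preceq> k" "k \<preceq> e" using assms S_E by blast
  note de = E0_D[OF d(1)] E0_D[OF e(1)]
  show ?thesis
  proof (rule S_convex)
    \<comment> \<open>Inversion reverses products, so the lower bound
      \<open>inv d \<otimes> inv e\<close> is the inverse of \<open>e \<otimes> d\<close>, not of
      the upper bound. Two different bounds are therefore used, and convexity concludes.\<close>
    show "inv (e \<otimes> d) \<in> S" "d \<otimes> e \<in> S"
      using E0_mult[OF e(1) d(1)] E0_mult[OF d(1) e(1)] by (simp_all add: E0_in_S S_inv)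
    show "inv (e \<otimes> d) \<preceq> g \<otimes> k" "g \<otimes> k \<preceq> d \<otimes> e"
      using d e de assms by (simp_all add: inv_mult_group mult_mono)
  qed (use assms in simp)
qed

lemma S_subgroup: "subgroup S K"
proof (rule subgroupI)
  show "S \<noteq> {}" using E0_in_S[OF one_in_E0] by blast
qed (simp_all add: S_inv S_mult subsetI)

text \<open>By convexity it suffices to squeeze both results: the join lies between \<open>g\<close>
  and \<open>d \<otimes> e\<close>, the meet between \<open>inv e \<otimes> inv d\<close> and
  \<open>g\<close>.\<close>

lemma S_join_meet:
  assumes "g \<in> S" "k \<in> S"
  shows "g \<squnion>\<^bsub>order_of K\<^esub> k \<in> S" "g \<sqinter>\<^bsub>order_of K\<^esub> k \<in> S"
proof -
  obtain d where d: "d \<in> E 0" "inv d \<preceq> g" "g \<preceq> d" using assms S_E by blast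
  obtain e where e: "e \<in> E 0" "inv e \<preceq> k" "k \<preceq> e" using assms S_E by blast
  note de = E0_D[OF d(1)] E0_D[OF e(1)]
  have "g \<preceq> d \<otimes> e" "k \<preceq> d \<otimes> e"
    using le_trans[of g d "d \<otimes> e"] le_trans[of k e "d \<otimes> e"] le_mult_left[of d e]
      le_mult_right[of e d] d e de assms by simp_all
  then have "g \<squnion>\<^bsub>order_of K\<^esub> k \<preceq> d \<otimes> e"
    using assms de by (simp add: join_least)
  then show "g \<squnion>\<^bsub>order_of K\<^esub> k \<in> S"
    using assms by (intro S_convex[OF assms(1) E0_in_S[OF E0_mult[OF d(1) e(1)]]])
      (simp_all add: join_left)
  have "inv e \<otimes> inv d \<preceq> g"
    using mult_mono[of "inv e" \<one> "inv d" g] inv_le_one[of e] d de assms by simp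
  moreover have "inv e \<otimes> inv d \<preceq> k"
    using mult_mono[of "inv e" k "inv d" \<one>] inv_le_one[of d] e de assms by simp
  ultimately have "inv e \<otimes> inv d \<preceq> g \<sqinter>\<^bsub>order_of K\<^esub> k"
    using assms de by (simp add: meet_greatest)
  then show "g \<sqinter>\<^bsub>order_of K\<^esub> k \<in> S"
    using assms by (intro S_convex[OF S_mult[OF E0_in_S[OF e(1), THEN S_inv] E0_in_S[OF d(1), THEN S_inv]] assms(1)])
      (simp_all add: meet_left)
qed

abbreviation G\<^sub>0 :: "'b lgroup"
  where "G\<^sub>0 \<equiv> K\<lparr>carrier := S\<rparr>"

lemma G0_lgroup: "lgroup G\<^sub>0"
proof -
  interpret G0: group G\<^sub>0
    by (rule subgroup.subgroup_is_group[OF S_subgroup is_group])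
  show ?thesis
  proof (intro lgroup.intro lgroup_axioms.intro)
    show "group G\<^sub>0" by (rule G0.is_group)
    interpret partial_order "order_of G\<^sub>0"
      by unfold_locales
        (simp_all add: order_of_def, blast intro: le_antisym S_closed, blast intro: le_trans S_closed)
    show "lattice (order_of G\<^sub>0)"
    proof unfold_locales
      fix x y assume "x \<in> carrier (order_of G\<^sub>0)" "y \<in> carrier (order_of G\<^sub>0)"
      then have xy: "x \<in> S" "y \<in> S" by (simp_all add: order_of_def)
      show "\<exists>s. least (order_of G\<^sub>0) s (Upper (order_of G\<^sub>0) {x, y})"
        using xy S_join_meet[OF xy]
        by (intro exI[of _ "x \<squnion>\<^bsub>order_of K\<^esub> y"])
           (auto simp: order_of_def[of G\<^sub>0] least_def Upper_def join_left join_right join_least)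
      show "\<exists>s. greatest (order_of G\<^sub>0) s (Lower (order_of G\<^sub>0) {x, y})"
        using xy S_join_meet[OF xy]
        by (intro exI[of _ "x \<sqinter>\<^bsub>order_of K\<^esub> y"])
           (auto simp: order_of_def[of G\<^sub>0] greatest_def Lower_def meet_left meet_right meet_greatest)
    qed
  next
    fix x y a b
    assume "x \<in> carrier G\<^sub>0" "y \<in> carrier G\<^sub>0" "a \<in> carrier G\<^sub>0" "b \<in> carrier G\<^sub>0" "x \<preceq>\<^bsub>G\<^sub>0\<^esub> y"
    then show "a \<otimes>\<^bsub>G\<^sub>0\<^esub> x \<otimes>\<^bsub>G\<^sub>0\<^esub> b \<preceq>\<^bsub>G\<^sub>0\<^esub> a \<otimes>\<^bsub>G\<^sub>0\<^esub> y \<otimes>\<^bsub>G\<^sub>0\<^esub> b"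
      by (simp add: translation)
  qed
qed

text \<open>The meet is chosen among lower bounds in the carrier, so shrinking the carrier changes
  the term. Closure of \<open>S\<close> under meets keeps its value, which links truncated sums over
  \<open>S\<close> to those in \<open>K\<close>.\<close>

lemma G0_meet:
  assumes "x \<in> S" "y \<in> S"
  shows "x \<sqinter>\<^bsub>order_of G\<^sub>0\<^esub> y = x \<sqinter>\<^bsub>order_of K\<^esub> y"
  using assms S_join_meet
  by (intro lgroup.meet_eqI[OF G0_lgroup]) (auto simp: meet_left meet_right meet_greatest)

section \<open>Each block as a translate of infinitesimals\<close>

lemma E_div_c:
  assumes t: "t \<in> I" and x: "x \<in> E t"
  shows "x \<otimes> inv (c t) \<in> S"
proof -
  define g where "g = x \<otimes> inv (c t)"
  define d where "d = g \<squnion>\<^bsub>order_of K\<^esub> \<one>"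
  define d' where "d' = inv g \<otimes> d"
  note xD = E_D[OF x t] and cD = E_D[OF c_in[OF t] t]
  have g: "g \<in> carrier K" using xD cD by (simp add: g_def)
  have d: "d \<in> carrier K" "\<one> \<preceq> d" and d': "d' \<in> carrier K" "\<one> \<preceq> d'"
    using g pos_part_decomp[of g] by (simp_all add: d_def d'_def one_le_join)
  have disj: "z \<preceq> \<one>" if "z \<in> carrier K" "z \<preceq> d" "z \<preceq> d'" for z
    using pos_neg_parts_disjoint[of g z] g that by (simp add: d_def d'_def)
  have gx: "g \<otimes> c t = x" using xD cD by (simp add: g_def m_assoc)
  show ?thesis
  proof (cases "t = 1")
    case True
    \<comment> \<open>At the top level \<open>c 1 = u\<close>, so \<open>- g\<close> is the left
      negation of \<open>x\<close> and falls into \<open>E 0\<close> directly.\<close>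
    have "inv g = u \<otimes> inv x"
      using xD cD by (simp add: g_def True c_one inv_mult_group)
    then have "inv g \<in> E 0"
      using E_neg[OF t x] True by simp
    then show ?thesis
      using S_inv[OF E0_in_S] g by (fastforce simp: g_def)
  next
    case False
    then have t1: "t < 1" using t by (simp add: unit_interval_iff)
    \<comment> \<open>Both sides are the join of \<open>x\<close> and \<open>c t\<close>, computed
      from either element. It lies below \<open>u\<close>, so neither sum is truncated and the level
      of the join can be read off in two ways.\<close>
    have prod: "c t \<otimes> d = x \<otimes> d'"
      using gx g d cD xD by (simp add: d'_def flip: gx) (simp add: m_assoc flip: c_commute[OF t, of g])
    have "d \<preceq> u \<otimes> inv (c t)"
      unfolding d_def using mult_right_mono[of x u "inv (c t)"] le_imp_one_le_div[of "c t" u] g xD cD u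
      by (intro join_least) (simp_all add: g_def)
    then have cd: "c t \<otimes> d \<preceq> u"
      using mult_right_mono[of d "u \<otimes> inv (c t)" "c t"] d u cD
      by (simp add: m_assoc c_commute[OF t])
    have "d \<preceq> u"
      using le_trans[OF le_mult_left cd] cD d u by simp
    then obtain s where s: "s \<in> I" "d \<in> E s" using obtain_level d by blast
    have "d' \<preceq> u"
      using le_trans[OF le_mult_left, of x d' u] cd prod xD d' u by simp
    then obtain s' where s': "s' \<in> I" "d' \<in> E s'" using obtain_level d' by blast
    have levels: "min (t + s) 1 = min (t + s') 1"
    proof (rule E_disjoint)
      show "c t \<otimes> d \<in> E (min (t + s) 1)" using E_mult[OF t s(1) c_in[OF t] s(2) cd] .
      show "c t \<otimes> d \<in> E (min (t + s') 1)" using E_mult[OF t s'(1) x s'(2)] cd prod by simp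
    qed (use add_in_H one_in_H t s s' in \<open>auto simp: unit_interval_iff min_def\<close>)
    \<comment> \<open>This bounds the level of \<open>d\<close> by \<open>t < 1\<close>, leaving
      room for a strictly higher level when \<open>d\<close> is doubled below.\<close>
    have "d \<preceq> x"
      unfolding d_def using g xD cD mult_left_mono[of "inv (c t)" \<one> x] inv_le_one[of "c t"]
      by (intro join_least) (simp_all add: g_def)
    then have "s \<le> t" using E_level_mono s t x by blast
    have d_one: "s = 0" if "d \<preceq> \<one>"
      using that le_antisym[of d \<one>] d E_disjoint[of s 0 \<one>] s one_in_E0 by simp
    have d'_one: "s' = 0" if "d' \<preceq> \<one>"
      using that le_antisym[of d' \<one>] d' E_disjoint[of s' 0 \<one>] s' one_in_E0 by simp
    have nonneg: "0 \<le> s" "0 \<le> s'" using s s' by (auto simp: unit_interval_iff)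
    \<comment> \<open>Because of the truncation at \<open>1\<close>, \<open>levels\<close> alone
      does not give \<open>s = s'\<close>. If \<open>s < s'\<close>, then \<open>d\<close> lies
      below \<open>d'\<close> and is trivial by disjointness; with \<open>s = 0\<close> the common
      level is \<open>t < 1\<close>, which forces \<open>s' = 0\<close>.\<close>
    have "\<not> s < s'"
    proof
      assume "s < s'"
      then have "s = 0" using E_less[of s s' d d'] s s' d by (intro d_one disj) auto
      then show False using levels \<open>s < s'\<close> t1 by (simp add: min_def split: if_splits)
    qed
    moreover have "\<not> s' < s"
    proof
      assume "s' < s"
      then have "s' = 0" using E_less[of s' s d' d] s s' d' by (intro d'_one disj) auto
      then show False using levels \<open>s' < s\<close> t1 by (simp add: min_def split: if_splits)
    qed
    ultimately have ss': "s' = s" by simp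
    have "s = 0"
    proof (rule ccontr)
      assume "s \<noteq> 0"
      \<comment> \<open>For \<open>0 < s < 1\<close> the truncated double of \<open>d\<close> has a
        level above \<open>s\<close>, so it dominates \<open>d'\<close>. Then
        \<open>- d + d'\<close> is below both \<open>d\<close> and \<open>d'\<close>, hence at most
        \<open>0\<close>; thus \<open>d' \<preceq> d\<close>, and disjointness makes
        \<open>d'\<close> trivial.\<close>
      let ?dd = "(d \<otimes> d) \<sqinter>\<^bsub>order_of K\<^esub> u"
      have "?dd \<in> E (min (s + s) 1)" by (rule E_add[OF s(1) s(1) s(2) s(2)])
      moreover have "min (s + s) 1 \<in> I"
        using s add_in_H[of s s] one_in_H unfolding unit_interval_iff min_def by auto
      ultimately have "d' \<preceq> ?dd"
        using E_less[of s "min (s + s) 1" d' ?dd] s s' ss' nonneg \<open>s \<noteq> 0\<close> \<open>s \<le> t\<close> t1 by simp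
      then have "d' \<preceq> d \<otimes> d"
        using le_trans[of d' ?dd "d \<otimes> d"] meet_left[of "d \<otimes> d" u] d d' u by simp
      then have "inv d \<otimes> d' \<preceq> d"
        using mult_left_mono[of d' "d \<otimes> d" "inv d"] d d' by simp
      moreover have "inv d \<otimes> d' \<preceq> d'"
        using mult_right_mono[of "inv d" \<one> d'] inv_le_one[of d] d d' by simp
      ultimately have "inv d \<otimes> d' \<preceq> \<one>" using d d' disj by simp
      then have "d' \<preceq> d"
        using mult_left_mono[of "inv d \<otimes> d'" \<one> d] d d' by simp
      then have "s' = 0" using d' by (intro d'_one disj) auto
      then show False using ss' \<open>s \<noteq> 0\<close> by simp
    qed
    then have "d \<in> S" "d' \<in> S" using s s' ss' E0_in_S by auto
    moreover have "g = d \<otimes> inv d'"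
      using g d by (simp add: d'_def inv_mult_group flip: m_assoc)
    ultimately show ?thesis
      using S_mult S_inv by (simp add: g_def)
  qed
qed

sublocale lex: real_lex G\<^sub>0 H
  by (intro real_lex.intro G0_lgroup unital_real_subgroup_axioms)

section \<open>The lexicographic order on the translates of \<open>S\<close>\<close>

lemma c_split:
  assumes "s \<in> I" "t \<in> I" "s \<le> t"
  shows "t - s \<in> I" "c t = c s \<otimes> c (t - s)"
proof -
  show ts: "t - s \<in> I"
    using assms diff_in_H by (simp add: unit_interval_iff)
  show "c t = c s \<otimes> c (t - s)"
    using c_add[OF assms(1) ts] assms by (simp add: unit_interval_iff)
qed

lemma S_le_c:
  assumes "t \<in> I" "0 < t" "g \<in> S"
  shows "g \<preceq> c t"
proof -
  obtain d where d: "d \<in> E 0" "inv d \<preceq> g" "g \<preceq> d" using assms(3) by (rule S_E)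
  have "d \<preceq> c t" using E_less[of 0 t d "c t"] d assms c_in by simp
  then show ?thesis using le_trans[of g d "c t"] d E0_D[OF d(1)] assms by simp
qed

lemma c_notin_S:
  assumes "t \<in> I" "0 < t"
  shows "c t \<notin> S"
proof
  assume "c t \<in> S"
  then obtain d where d: "d \<in> E 0" "c t \<preceq> d" by (rule S_E)
  then show False
    using E_level_mono[of t 0 "c t" d] c_in assms by simp
qed

text \<open>After cancelling \<open>c s\<close>, with \<open>r = t - s > 0\<close>, the claim
  compares \<open>g - k\<close> with \<open>c r\<close>. The former lies in \<open>S\<close>, all of
  which is below \<open>c r\<close>, while \<open>c r\<close> itself is outside
  \<open>S\<close>.\<close>

lemma c_mult_le:
  assumes "s \<in> I" "t \<in> I" "s < t" "g \<in> S" "k \<in> S"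
  shows "c s \<otimes> g \<preceq> c t \<otimes> k" "c s \<otimes> g \<noteq> c t \<otimes> k"
proof -
  define r where "r = t - s"
  have r: "r \<in> I" "0 < r" "c t = c s \<otimes> c r"
    using c_split[of s t] assms by (simp_all add: r_def)
  have "g \<otimes> inv k \<preceq> c r"
    using S_le_c[OF r(1,2)] S_mult S_inv assms by simp
  then have "g \<preceq> c r \<otimes> k"
    using mult_right_mono[of "g \<otimes> inv k" "c r" k] r assms by (simp add: m_assoc)
  then show "c s \<otimes> g \<preceq> c t \<otimes> k"
    using mult_left_mono[of g "c r \<otimes> k" "c s"] r assms by (simp add: m_assoc)
  show "c s \<otimes> g \<noteq> c t \<otimes> k"
  proof
    assume "c s \<otimes> g = c t \<otimes> k"
    then have "c s \<otimes> g = c s \<otimes> (c r \<otimes> k)" using r assms by (simp add: m_assoc)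
    then have "g = c r \<otimes> k" using r assms by simp
    then have "c r = g \<otimes> inv k" using r assms by (simp add: m_assoc)
    then show False using c_notin_S[OF r(1,2)] S_mult S_inv assms by simp
  qed
qed

lemma c_mult_le_iff:
  assumes "s \<in> I" "t \<in> I" "g \<in> S" "k \<in> S"
  shows "c s \<otimes> g \<preceq> c t \<otimes> k \<longleftrightarrow> s < t \<or> s = t \<and> g \<preceq> k"
proof (cases s t rule: linorder_cases)
  case equal
  then show ?thesis using assms by (simp add: mult_left_le_cancel)
next
  case greater
  then have "\<not> c s \<otimes> g \<preceq> c t \<otimes> k"
    using c_mult_le[of t s k g] assms le_antisym[of "c s \<otimes> g" "c t \<otimes> k"] by auto
  then show ?thesis using greater by simp
qed (use c_mult_le assms in simp)

lemma c_mult_eq_iff: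
  assumes "s \<in> I" "t \<in> I" "g \<in> S" "k \<in> S"
  shows "c s \<otimes> g = c t \<otimes> k \<longleftrightarrow> s = t \<and> g = k"
  using assms c_mult_le(2)[of s t g k] c_mult_le(2)[of t s k g]
  by (cases s t rule: linorder_cases) auto

lemma one_in_S: "\<one> \<in> S"
  by (rule E0_in_S[OF one_in_E0])

section \<open>The isomorphism with the unit interval of \<open>K\<close>\<close>

definition \<psi> :: "real \<times> 'b \<Rightarrow> 'b"
  where "\<psi> = (\<lambda>(t, g). c t \<otimes> g)"

text \<open>A constant rather than an abbreviation: the simplifier would turn \<open>\<one>\<^bsub>G\<^sub>0\<^esub>\<close> into
  \<open>\<one>\<close> inside \<open>lex.\<Gamma>\<close>, after which the rules of \<open>real_lex\<close> no longer match.\<close>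

definition \<Gamma>\<^sub>0 :: "(real \<times> 'b) pmv"
  where "\<Gamma>\<^sub>0 = lex.\<Gamma>"

text \<open>The conditions on \<open>(t, g)\<close> are comparisons with \<open>(0, \<one>)\<close>
  and \<open>(1, \<one>)\<close>. As \<open>c 0 = \<one>\<close> and \<open>c 1 = u\<close>,
  \<open>c_mult_le_iff\<close> turns them into bounds on \<open>c t \<otimes> g\<close>.\<close>

lemma Gamma0_carrier_iff:
  "(t, g) \<in> carrier \<Gamma>\<^sub>0 \<longleftrightarrow> t \<in> I \<and> g \<in> S \<and> \<one> \<preceq> c t \<otimes> g \<and> c t \<otimes> g \<preceq> u"
proof -
  have "(t, g) \<in> carrier \<Gamma>\<^sub>0 \<longleftrightarrow> t \<in> I \<and> g \<in> S
      \<and> (0 < t \<or> t = 0 \<and> \<one> \<preceq> g) \<and> (t < 1 \<or> t = 1 \<and> g \<preceq> \<one>)"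
    unfolding \<Gamma>\<^sub>0_def lex.Gamma_simps unit_interval_iff by auto
  then show ?thesis
    using c_mult_le_iff[of 0 t \<one> g] c_mult_le_iff[of t 1 g \<one>] one_in_S u
    by (auto simp: c_zero c_one)
qed

lemma Gamma0_padd:
  assumes "s \<in> H" "g \<in> S" "t \<in> H" "k \<in> S"
  shows "(s, g) \<boxplus>\<^bsub>\<Gamma>\<^sub>0\<^esub> (t, k) = (if s + t < 1 then (s + t, g \<otimes> k)
      else if s + t = 1 then (1, (g \<otimes> k) \<sqinter>\<^bsub>order_of K\<^esub> \<one>) else (1, \<one>))"
proof -
  have "(g \<otimes> k) \<sqinter>\<^bsub>order_of G\<^sub>0\<^esub> \<one> = (g \<otimes> k) \<sqinter>\<^bsub>order_of K\<^esub> \<one>"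
    using assms by (intro G0_meet S_mult one_in_S)
  then show ?thesis
    using assms unfolding \<Gamma>\<^sub>0_def by (subst lex.Gamma_padd) simp_all
qed

lemma Gamma0_neg:
  assumes "t \<in> H" "g \<in> S"
  shows "lneg \<Gamma>\<^sub>0 (t, g) = (1 - t, inv g)" "rneg \<Gamma>\<^sub>0 (t, g) = (1 - t, inv g)"
proof -
  have "inv\<^bsub>G\<^sub>0\<^esub> g = inv g" by (rule m_inv_consistent[OF S_subgroup assms(2)])
  then show "lneg \<Gamma>\<^sub>0 (t, g) = (1 - t, inv g)" "rneg \<Gamma>\<^sub>0 (t, g) = (1 - t, inv g)"
    using lex.Gamma_neg[of t g] assms unfolding \<Gamma>\<^sub>0_def by simp_all
qed

lemma Gamma0_consts: "pzero \<Gamma>\<^sub>0 = (0, \<one>)" "pone \<Gamma>\<^sub>0 = (1, \<one>)"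
  unfolding \<Gamma>\<^sub>0_def lex.Gamma_simps by simp_all

lemma K_Gamma_simps:
  "carrier (pmv_Gamma K u) = {x \<in> carrier K. \<one> \<preceq> x \<and> x \<preceq> u}"
  "x \<boxplus>\<^bsub>pmv_Gamma K u\<^esub> y = (x \<otimes> y) \<sqinter>\<^bsub>order_of K\<^esub> u"
  "lneg (pmv_Gamma K u) x = u \<otimes> inv x" "rneg (pmv_Gamma K u) x = inv x \<otimes> u"
  "pzero (pmv_Gamma K u) = \<one>" "pone (pmv_Gamma K u) = u"
  by (simp_all add: pmv_Gamma_def)

text \<open>Centrality gathers the product as
  \<open>c s \<otimes> c t \<otimes> (g \<otimes> k)\<close>. For \<open>s + t < 1\<close> it is
  already below \<open>u\<close>, for \<open>s + t = 1\<close> the factor \<open>u\<close> comes out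
  of the meet, and for \<open>s + t > 1\<close> the product exceeds \<open>u\<close>.\<close>

lemma psi_padd:
  assumes s: "s \<in> I" "g \<in> S" and t: "t \<in> I" "k \<in> S"
  shows "\<psi> ((s, g) \<boxplus>\<^bsub>\<Gamma>\<^sub>0\<^esub> (t, k)) = (\<psi> (s, g) \<otimes> \<psi> (t, k)) \<sqinter>\<^bsub>order_of K\<^esub> u"
proof -
  have st: "s \<in> H" "t \<in> H" "0 \<le> s" "0 \<le> t" "s \<le> 1" "t \<le> 1"
    using s t by (auto simp: unit_interval_iff)
  have gk: "g \<otimes> k \<in> S" using s t S_mult by simp
  have padd: "(s, g) \<boxplus>\<^bsub>\<Gamma>\<^sub>0\<^esub> (t, k) = (if s + t < 1 then (s + t, g \<otimes> k)
      else if s + t = 1 then (1, (g \<otimes> k) \<sqinter>\<^bsub>order_of K\<^esub> \<one>) else (1, \<one>))"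
    using st s t gk one_in_S by (simp add: Gamma0_padd)
  have prod: "\<psi> (s, g) \<otimes> \<psi> (t, k) = c s \<otimes> c t \<otimes> (g \<otimes> k)"
    using s t by (simp add: \<psi>_def m_assoc c_commute[of t "g \<otimes> k"] c_commute[of t k])
  consider "s + t < 1" | "s + t = 1" | "s + t > 1" by linarith
  then show ?thesis
  proof cases
    case 1
    then have "s + t \<in> I" using st add_in_H by (simp add: unit_interval_iff)
    moreover from this have "c (s + t) \<otimes> (g \<otimes> k) \<preceq> u"
      using c_mult_le(1)[of "s + t" 1 "g \<otimes> k" \<one>] 1 gk one_in_S u by (simp add: c_one)
    ultimately show ?thesis
      using 1 prod padd c_add[of s t] s t gk u by (simp add: \<psi>_def meet_absorb)
  next
    case 2
    then have "\<psi> (s, g) \<otimes> \<psi> (t, k) = u \<otimes> (g \<otimes> k)"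
      using prod c_add[of s t] s t by (simp add: c_one)
    then show ?thesis
      using 2 padd u gk mult_meet_distrib[of u "g \<otimes> k" \<one>] by (simp add: \<psi>_def c_one)
  next
    case 3
    \<comment> \<open>The excess over the unit: splitting \<open>c t\<close> at \<open>1 - s\<close>
      completes \<open>c s\<close> to \<open>u\<close> and leaves \<open>c r\<close>. Since
      \<open>r > 0\<close>, \<open>c r\<close> outweighs \<open>g \<otimes> k\<close>, so what
      follows \<open>u\<close> is positive.\<close>
    define r where "r = s + t - 1"
    have s': "1 - s \<in> I" using st diff_in_H one_in_H by (simp add: unit_interval_iff)
    have r: "r \<in> I" "0 < r" "c t = c (1 - s) \<otimes> c r"
      using c_split[OF s' t(1)] 3 by (simp_all add: r_def algebra_simps)
    have "c s \<otimes> c (1 - s) = u"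
      using c_add[OF s(1) s'] by (simp add: c_one)
    then have "c s \<otimes> c t = u \<otimes> c r"
      using r s s' by (simp flip: m_assoc)
    then have eq: "\<psi> (s, g) \<otimes> \<psi> (t, k) = u \<otimes> (c r \<otimes> (g \<otimes> k))"
      using prod r s t u by (simp add: m_assoc)
    have "\<one> \<preceq> c r \<otimes> (g \<otimes> k)"
      using c_mult_le(1)[of 0 r \<one> "g \<otimes> k"] r gk one_in_S by (simp add: c_zero)
    then have "u \<preceq> \<psi> (s, g) \<otimes> \<psi> (t, k)"
      using le_mult_right[of "c r \<otimes> (g \<otimes> k)" u] r gk u by (simp add: eq)
    then have "(\<psi> (s, g) \<otimes> \<psi> (t, k)) \<sqinter>\<^bsub>order_of K\<^esub> u = u"
      using u s t by (intro meet_eqI) (auto simp: \<psi>_def)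
    then show ?thesis
      using 3 padd u by (simp add: \<psi>_def c_one)
  qed
qed

text \<open>The elements \<open>\<psi> (1 - t, inv g)\<close> and \<open>\<psi> (t, g)\<close>
  multiply to \<open>u\<close>. Since \<open>u = c 1\<close> is central, subtracting from the left
  or from the right gives the same result.\<close>

lemma psi_neg:
  assumes "t \<in> I" "g \<in> S"
  shows "\<psi> (1 - t, inv g) = u \<otimes> inv (\<psi> (t, g))" "\<psi> (1 - t, inv g) = inv (\<psi> (t, g)) \<otimes> u"
proof -
  have t': "1 - t \<in> I" "c (1 - t) \<otimes> c t = u"
    using c_split[of t 1] c_add[of "1 - t" t] assms by (simp_all add: c_one unit_interval_iff[of t])
  have "\<psi> (1 - t, inv g) \<otimes> \<psi> (t, g) = u"
    using t' assms by (simp add: \<psi>_def m_assoc c_commute[of t g])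
  then show eq: "\<psi> (1 - t, inv g) = u \<otimes> inv (\<psi> (t, g))"
    using t' assms by (auto simp: \<psi>_def inv_solve_right)
  have "u \<in> carrier K" "\<And>x. x \<in> carrier K \<Longrightarrow> u \<otimes> x = x \<otimes> u"
    using c_commute[of 1] u by (simp_all add: c_one)
  then show "\<psi> (1 - t, inv g) = inv (\<psi> (t, g)) \<otimes> u"
    using eq assms by (simp add: \<psi>_def)
qed

theorem psi_pmv_iso: "\<psi> \<in> pmv_iso \<Gamma>\<^sub>0 (pmv_Gamma K u)"
proof -
  have bij: "bij_betw \<psi> (carrier \<Gamma>\<^sub>0) (carrier (pmv_Gamma K u))"
  proof (rule bij_betw_imageI)
    show "inj_on \<psi> (carrier \<Gamma>\<^sub>0)"
    proof (rule inj_onI)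
      fix x y assume "x \<in> carrier \<Gamma>\<^sub>0" "y \<in> carrier \<Gamma>\<^sub>0" "\<psi> x = \<psi> y"
      then show "x = y"
        by (cases x, cases y) (simp add: Gamma0_carrier_iff \<psi>_def c_mult_eq_iff)
    qed
    show "\<psi> ` carrier \<Gamma>\<^sub>0 = carrier (pmv_Gamma K u)"
    proof (intro equalityI subsetI)
      fix y assume "y \<in> \<psi> ` carrier \<Gamma>\<^sub>0"
      then obtain t g where "(t, g) \<in> carrier \<Gamma>\<^sub>0" "y = \<psi> (t, g)" by auto
      then show "y \<in> carrier (pmv_Gamma K u)"
        unfolding Gamma0_carrier_iff K_Gamma_simps by (simp add: \<psi>_def)
    next
      fix y assume "y \<in> carrier (pmv_Gamma K u)"
      then have y: "y \<in> carrier K" "\<one> \<preceq> y" "y \<preceq> u" by (simp_all add: K_Gamma_simps)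
      then obtain t where t: "t \<in> I" "y \<in> E t" by (rule obtain_level)
      \<comment> \<open>Surjectivity rests on \<open>E_div_c\<close>: removing the cyclic element of
        its block from \<open>y\<close> leaves an element of \<open>S\<close>.\<close>
      define g where "g = y \<otimes> inv (c t)"
      have g: "g \<in> S" using E_div_c[OF t] by (simp add: g_def)
      have "c t \<otimes> g = y"
        using c_commute[OF t(1), of g] t y g by (simp add: g_def m_assoc)
      then have "(t, g) \<in> carrier \<Gamma>\<^sub>0" "\<psi> (t, g) = y"
        unfolding Gamma0_carrier_iff using t g y by (simp_all add: \<psi>_def)
      then show "y \<in> \<psi> ` carrier \<Gamma>\<^sub>0" by (metis imageI)
    qed
  qed
  have level: "t \<in> I" "t \<in> H" "g \<in> S" if "(t, g) \<in> carrier \<Gamma>\<^sub>0" for t g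
    using that unfolding Gamma0_carrier_iff by (simp_all add: unit_interval_iff)
  have add: "\<psi> (x \<boxplus>\<^bsub>\<Gamma>\<^sub>0\<^esub> y) = \<psi> x \<boxplus>\<^bsub>pmv_Gamma K u\<^esub> \<psi> y"
    if "x \<in> carrier \<Gamma>\<^sub>0" "y \<in> carrier \<Gamma>\<^sub>0" for x y
    using that psi_padd level by (cases x, cases y) (simp add: K_Gamma_simps)
  have neg: "\<psi> (lneg \<Gamma>\<^sub>0 x) = lneg (pmv_Gamma K u) (\<psi> x) \<and> \<psi> (rneg \<Gamma>\<^sub>0 x) = rneg (pmv_Gamma K u) (\<psi> x)"
    if x: "x \<in> carrier \<Gamma>\<^sub>0" for x
  proof -
    obtain t g where tg: "x = (t, g)" by (cases x)
    note l = level[OF x[unfolded tg]]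
    show ?thesis
      using l Gamma0_neg[of t g] psi_neg[of t g] by (simp add: tg K_Gamma_simps)
  qed
  have "\<psi> (pzero \<Gamma>\<^sub>0) = \<one>" "\<psi> (pone \<Gamma>\<^sub>0) = u"
    using u by (simp_all add: \<psi>_def c_zero c_one Gamma0_consts)
  then show ?thesis
    using bij add neg unfolding pmv_iso_def by (simp add: K_Gamma_simps(5,6))
qed

end

section \<open>The representation theorem\<close>

text \<open>The algebra order is an equation between nested truncated sums. With \<open>z\<close>
  the inner and \<open>w\<close> the outer sum it says \<open>w = u - x\<close>. Replacing
  \<open>z\<close> by its larger untruncated value yields \<open>u - y \<preceq> w\<close>, hence
  \<open>u - y \<preceq> u - x\<close>.\<close>

lemma (in lgroup) pmv_le_Gamma_imp_le:
  assumes "pmv_le (pmv_Gamma G u) x y" "u \<in> carrier G" "x \<in> carrier G" "y \<in> carrier G" "\<one> \<preceq> y"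
  shows "x \<preceq> y"
proof -
  define z where "z = (u \<otimes> inv x \<otimes> y) \<sqinter>\<^sub>l u"
  define w where "w = (u \<otimes> inv z \<otimes> (u \<otimes> inv x)) \<sqinter>\<^sub>l u"
  have z: "z \<in> carrier G" and w: "w \<in> carrier G" using assms by (simp_all add: z_def w_def)
  have "inv w \<otimes> u = x"
    using assms(1) by (simp add: pmv_le_def pmv_meet_def pmul_def pmv_Gamma_def z_def w_def)
  then have w_eq: "w = u \<otimes> inv x"
    using w assms by (auto simp: inv_mult_group)
  have "z \<preceq> u \<otimes> inv x \<otimes> y" using assms by (simp add: z_def meet_left)
  then have "inv (u \<otimes> inv x \<otimes> y) \<preceq> inv z"
    using z assms by (simp add: inv_antimono)
  then have "u \<otimes> inv (u \<otimes> inv x \<otimes> y) \<otimes> (u \<otimes> inv x) \<preceq> u \<otimes> inv z \<otimes> (u \<otimes> inv x)"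
    using z assms by (intro mult_right_mono mult_left_mono) simp_all
  then have "u \<otimes> inv y \<preceq> u \<otimes> inv z \<otimes> (u \<otimes> inv x)"
    using assms by (simp add: inv_mult_group m_assoc)
  moreover have "u \<otimes> inv y \<preceq> u"
    using mult_left_mono[of "inv y" \<one> u] inv_le_one[of y] assms by simp
  ultimately have "u \<otimes> inv y \<preceq> w"
    using z assms by (simp add: w_def meet_greatest)
  then have "inv y \<preceq> inv x"
    using assms by (simp add: w_eq mult_left_le_cancel)
  then show ?thesis
    using inv_antimono[of "inv y" "inv x"] assms by simp
qed

lemma strong_H_perfect_imp_perfect_interval:
  assumes H: "subgroup H real_lgroup" "1 \<in> H"
    and M: "pmv_algebra M"
    and rep: "pmv_representation M K u \<phi>"
    and dec: "H_decomposition H M D"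
    and c: "\<And>t. t \<in> unit_interval H \<Longrightarrow> c t \<in> D t \<and> \<phi> (c t) \<in> group_center K"
      "\<And>s t. \<lbrakk>s \<in> unit_interval H; t \<in> unit_interval H; s + t \<le> 1\<rbrakk>
        \<Longrightarrow> pmv_plus M (c s) (c t) = Some (c (s + t))"
      "c 1 = pone M"
  shows "perfect_interval K H u (\<lambda>t. \<phi> ` D t) (\<phi> \<circ> c)"
proof -
  interpret M: pmv_algebra M by fact
  interpret K: lgroup K using rep by (simp add: pmv_representation_def unital_lgroup_def)
  interpret H: unital_real_subgroup H using H by (rule unital_real_subgroup.intro)
  let ?I = "unit_interval H" and ?\<Gamma> = "pmv_Gamma K u"
  have \<phi>: "\<phi> \<in> pmv_iso M ?\<Gamma>" using rep by (simp add: pmv_representation_def)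
  have u: "u \<in> carrier K" "\<one>\<^bsub>K\<^esub> \<preceq>\<^bsub>K\<^esub> u"
    using rep by (simp_all add: pmv_representation_def unital_lgroup_def strong_unit_def)
  have bij: "bij_betw \<phi> (carrier M) (carrier ?\<Gamma>)"
    and hom: "\<And>x y. \<lbrakk>x \<in> carrier M; y \<in> carrier M\<rbrakk> \<Longrightarrow> \<phi> (x \<boxplus>\<^bsub>M\<^esub> y) = (\<phi> x \<otimes>\<^bsub>K\<^esub> \<phi> y) \<sqinter>\<^bsub>order_of K\<^esub> u"
      "\<And>x. x \<in> carrier M \<Longrightarrow> \<phi> (lneg M x) = u \<otimes>\<^bsub>K\<^esub> inv\<^bsub>K\<^esub> \<phi> x"
      "\<phi> (pone M) = u"
    using \<phi> by (auto simp: pmv_iso_def pmv_Gamma_def)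
  have D_in: "x \<in> carrier M" if "x \<in> D t" "t \<in> ?I" for x t
    using dec that by (auto simp: H_decomposition_def)
  have \<phi>_in: "\<phi> x \<in> carrier K" "\<one>\<^bsub>K\<^esub> \<preceq>\<^bsub>K\<^esub> \<phi> x" "\<phi> x \<preceq>\<^bsub>K\<^esub> u" if "x \<in> carrier M" for x
    using bij_betw_apply[OF bij that] by (simp_all add: pmv_Gamma_def)
  have le: "\<phi> x \<preceq>\<^bsub>K\<^esub> \<phi> y" if "x \<in> carrier M" "y \<in> carrier M" "pmv_le M x y" for x y
    using K.pmv_le_Gamma_imp_le[OF pmv_iso_le[OF M \<phi> that]] u \<phi>_in that by simp
  show ?thesis
  proof
    show "u \<in> carrier K" "\<one>\<^bsub>K\<^esub> \<preceq>\<^bsub>K\<^esub> u" by (fact u)+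
    have "(\<Union>t\<in>?I. D t) = carrier M" using dec by (simp add: H_decomposition_def)
    then show "(\<Union>t\<in>?I. \<phi> ` D t) = {x \<in> carrier K. \<one>\<^bsub>K\<^esub> \<preceq>\<^bsub>K\<^esub> x \<and> x \<preceq>\<^bsub>K\<^esub> u}"
      using bij_betw_imp_surj_on[OF bij] by (simp add: pmv_Gamma_def flip: image_UN)
  next
    fix s t x assume st: "s \<in> ?I" "t \<in> ?I" "x \<in> \<phi> ` D s" "x \<in> \<phi> ` D t"
    then obtain a b where ab: "a \<in> D s" "b \<in> D t" "\<phi> a = x" "\<phi> b = x" by auto
    then have "a = b"
      using bij_betw_imp_inj_on[OF bij] D_in st by (metis inj_onD)
    then have "D s \<inter> D t \<noteq> {}" using ab by auto
    then show "s = t" using dec st by (auto simp: H_decomposition_def)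
  next
    fix s t x y assume st: "s \<in> ?I" "t \<in> ?I" "s < t" "x \<in> \<phi> ` D s" "y \<in> \<phi> ` D t"
    then obtain a b where ab: "a \<in> D s" "b \<in> D t" "x = \<phi> a" "y = \<phi> b" by auto
    then have "pmv_le M a b" using dec st by (simp add: H_decomposition_def)
    then show "x \<preceq>\<^bsub>K\<^esub> y" using le D_in ab st by simp
  next
    fix t x assume t: "t \<in> ?I" "x \<in> \<phi> ` D t"
    then obtain a where a: "a \<in> D t" "x = \<phi> a" by auto
    have "lneg M ` D t = D (1 - t)" using dec t by (simp add: H_decomposition_def)
    then have "\<phi> (lneg M a) \<in> \<phi> ` D (1 - t)" using a by blast
    then show "u \<otimes>\<^bsub>K\<^esub> inv\<^bsub>K\<^esub> x \<in> \<phi> ` D (1 - t)" using hom D_in t a by simp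
  next
    fix s t x y assume st: "s \<in> ?I" "t \<in> ?I" "x \<in> \<phi> ` D s" "y \<in> \<phi> ` D t"
    then obtain a b where ab: "a \<in> D s" "b \<in> D t" "x = \<phi> a" "y = \<phi> b" by auto
    then have "a \<boxplus>\<^bsub>M\<^esub> b \<in> D (min (s + t) 1)" using dec st by (simp add: H_decomposition_def)
    then have "\<phi> (a \<boxplus>\<^bsub>M\<^esub> b) \<in> \<phi> ` D (min (s + t) 1)" by (rule imageI)
    then show "(x \<otimes>\<^bsub>K\<^esub> y) \<sqinter>\<^bsub>order_of K\<^esub> u \<in> \<phi> ` D (min (s + t) 1)"
      using hom D_in st ab by simp
  next
    fix s t assume st: "s \<in> ?I" "t \<in> ?I" "s + t \<le> 1"
    have cM: "c s \<in> carrier M" "c t \<in> carrier M" using c(1) D_in st by blast+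
    have plus: "pmv_le M (c s) (lneg M (c t))" "c s \<boxplus>\<^bsub>M\<^esub> c t = c (s + t)"
      using c(2)[OF st] by (auto simp: pmv_plus_def split: if_splits)
    \<comment> \<open>Definedness of the partial sum is what bounds the group product by
      \<open>u\<close>; the truncated sum in \<open>hom\<close> is then the product itself.\<close>
    have "\<phi> (c s) \<preceq>\<^bsub>K\<^esub> u \<otimes>\<^bsub>K\<^esub> inv\<^bsub>K\<^esub> \<phi> (c t)"
      using le[OF cM(1) M.lneg_closed[OF cM(2)] plus(1)] hom cM by simp
    then have "\<phi> (c s) \<otimes>\<^bsub>K\<^esub> \<phi> (c t) \<preceq>\<^bsub>K\<^esub> u"
      using K.mult_right_mono[of "\<phi> (c s)" "u \<otimes>\<^bsub>K\<^esub> inv\<^bsub>K\<^esub> \<phi> (c t)" "\<phi> (c t)"] \<phi>_in cM u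
      by (simp add: K.m_assoc)
    then show "(\<phi> \<circ> c) s \<otimes>\<^bsub>K\<^esub> (\<phi> \<circ> c) t = (\<phi> \<circ> c) (s + t)"
      using hom(1)[OF cM] plus(2) \<phi>_in cM u K.meet_absorb by simp
  qed (use c hom in auto)
qed

theorem theorem4p3:
  fixes H :: "real set"
    and M :: "'a pmv"
    and K :: "'b lgroup" and u :: 'b and \<phi> :: "'a \<Rightarrow> 'b"
  assumes "subgroup H real_lgroup" and "1 \<in> H"
    and "pmv_algebra M"
    and "pmv_representation M K u \<phi>"
    and "strong_H_perfect H M K \<phi>"
  shows "\<exists>G :: 'b lgroup.
     lgroup G \<and>
     pmv_isomorphic M (pmv_Gamma (lex_lgroup (real_lgroup\<lparr>carrier := H\<rparr>) G) (1, \<one>\<^bsub>G\<^esub>)) \<and>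
     (\<forall>G' :: 'c lgroup.
        lgroup G' \<and>
        pmv_isomorphic M (pmv_Gamma (lex_lgroup (real_lgroup\<lparr>carrier := H\<rparr>) G') (1, \<one>\<^bsub>G'\<^esub>))
        \<longrightarrow> lgroup_isomorphic G G')"
proof -
  obtain D where dec: "H_decomposition H M D" and cyc: "strong_cyclic H M K \<phi> D"
    using assms(5) by (auto simp: strong_H_perfect_def)
  obtain c where c: "\<And>t. t \<in> unit_interval H \<Longrightarrow> c t \<in> D t \<and> \<phi> (c t) \<in> group_center K"
      "\<And>s t. \<lbrakk>s \<in> unit_interval H; t \<in> unit_interval H; s + t \<le> 1\<rbrakk>
        \<Longrightarrow> pmv_plus M (c s) (c t) = Some (c (s + t))"
      "c 1 = pone M"
    using cyc unfolding strong_cyclic_def by blast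
  interpret perfect_interval K H u "\<lambda>t. \<phi> ` D t" "\<phi> \<circ> c"
    by (rule strong_H_perfect_imp_perfect_interval[OF assms(1-4) dec c])
  interpret M: pmv_algebra M by fact
  have "pmv_isomorphic M (pmv_Gamma K u)"
    using assms(4) by (auto simp: pmv_representation_def pmv_isomorphic_def)
  \<comment> \<open>The map \<open>\<psi>\<close> runs in the opposite direction, so it is inverted
    by means of the closure properties of \<open>lex.\<Gamma>\<close>.\<close>
  moreover have "pmv_isomorphic (pmv_Gamma K u) lex.\<Gamma>"
    using psi_pmv_iso unfolding \<Gamma>\<^sub>0_def
    by (intro lex.Gamma_pmv_isomorphic_sym) (unfold pmv_isomorphic_def, blast)
  ultimately have iso: "pmv_isomorphic M lex.\<Gamma>"
    by (rule pmv_isomorphic_trans)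
  have "lgroup_isomorphic G\<^sub>0 G'"
    if "lgroup G'" "pmv_isomorphic M (pmv_Gamma (lex_lgroup (real_lgroup\<lparr>carrier := H\<rparr>) G') (1, \<one>\<^bsub>G'\<^esub>))"
    for G' :: "'c lgroup"
  proof (rule lex_Gamma_isomorphic_imp)
    show "real_lex G\<^sub>0 H" by (rule lex.real_lex_axioms)
    show "real_lex G' H" using that(1) unital_real_subgroup_axioms by (rule real_lex.intro)
    \<comment> \<open>The two lexicographic algebras are compared through \<open>M\<close>, whose
      axioms allow \<open>iso\<close> to be inverted.\<close>
    show "pmv_isomorphic lex.\<Gamma> (pmv_Gamma (lex_lgroup (real_lgroup\<lparr>carrier := H\<rparr>) G') (1, \<one>\<^bsub>G'\<^esub>))"
      using M.pmv_isomorphic_sym[OF iso] that(2) by (rule pmv_isomorphic_trans)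
  qed
  then show ?thesis
    using G0_lgroup iso by blast
qed

end
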